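(* Let $\rho$ be an additively indecomposable ordinal and let $\alpha$ be an ordinal which is not divisible by $\rho$. For every ordinal $\gamma$, if $[0,\alpha)\not\leq_2[\alpha,\alpha+\gamma)$, then $[1,1+\gamma]\cong[\alpha,\alpha+\gamma]$.
   Context: $ORD$ is the class of ordinals with its usual order and arithmetic; intervals are intervals of ordinals. $\rho$ is a fixed additively indecomposable ordinal (nonzero and closed under addition; $\rho=1$ is allowed). An ordinal $\beta$ is divisible by (a multiple of) $\alpha$ if $\beta=\alpha\cdot\delta$ for some $\delta$. For $\xi<\rho$ define $f_\xi:ORD\to ORD$ by $f_\xi(\rho\cdot\zeta)=\rho\cdot\zeta+\xi$ and $f_\xi(\rho\cdot\zeta+\epsilon)=\rho\cdot\zeta$ if $0<\epsilon<\rho$. A set $X$ of ordinals is closed if $\sigma\in X$ whenever $\sigma$ is divisible by $\rho$ and $\sigma+\xi\in X$ for some $\xi<\rho$. For sets of ordinals, $X<Y$ means $x<y$ for all $x\in X$, $y\in Y$. Binary relations $\leq_1,\leq_2$ on $ORD$ are defined by recursion on the larger argument $\beta$ as below. A covering of a closed set $X$ is a strictly increasing $h:X\to ORD$ such that for all $x,y\in X$: $f_\xi(x)=y$ iff $f_\xi(h(x))=h(y)$ for every $\xi<\rho$; and $x\leq_k y$ implies $h(x)\leq_k h(y)$ for $k=1,2$. A set $Z$ is a covering of $X$ if it is the range of a covering of $X$. "Cofinally many $\tilde Y$ below $\alpha$" with a property means: for every $\gamma<\alpha$ there is such a finite $\tilde Y\subseteq(\gamma,\alpha)$. (i) $\alpha\leq_1\beta$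 iff $\alpha\leq\beta$ and for all finite $X\subseteq\alpha$ and finite $Y\subseteq[\alpha,\beta)$ with $X\cup Y$ closed there is a finite $\tilde Y\subseteq\alpha$ with $X<\tilde Y$ such that $X\cup\tilde Y$ is a covering of $X\cup Y$. (ii) $\alpha\leq_2\beta$ iff $\alpha\leq\beta$ and both of the following hold. (Up, written $\alpha\leq_2\uparrow\beta$) For all finite $X,Y\subseteq\alpha$ with $X\cup Y$ closed and $X<Y$: if there are cofinally many $\tilde Y$ below $\alpha$ such that $X\cup\tilde Y$ is a covering of $X\cup Y$, then there are cofinally many $\tilde Y$ below $\beta$ such that $X\cup\tilde Y$ is a covering of $X\cup Y$. (Down, written $\alpha\leq_2\downarrow\beta$) For all finite $X\subseteq\alpha$ and finite $Y\subseteq[\alpha,\beta)$ with $X\cup Y$ closed there is a finite $\tilde Y\subseteq\alpha$ with $X<\tilde Y$ such that $X\cup\tilde Y$ is a covering of $X\cup Y$ and, for every $i$ less than the cardinality of $Y$, if the $i$-th element of $Y$ is $\leq_1\beta$ then the $i$-th element of $\tilde Y$ is $\leq_1\alpha$. $\alpha<_k\beta$ means $\alpha\leq_k\beta$ and $\alpha\neq\beta$. For classes $A,B$ of ordinals, $A\not\leq_k B$ means $a\not\leq_k b$ for all $a\in A$, $b\in B$. $A\cong B$ means there is an order-preserving bijection $h:A\to B$ such that for all $x,y\in A$: $f_\xi(x)=y$ iff $f_\xi(h(x))=h(y)$ for every $\xi<\rho$, and $x\leq_k y$ iff $h(x)\leq_k h(y)$ for $k=1,2$. *)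

theory Defs
  imports Main "HOL-Library.Infinite_Typeclass"
begin

unbundle cardinal_syntax

section \<open>Ordinals\<close>

text \<open>
  An ordinal over \<open>'a\<close> is an isomorphism class of well-orders whose field is a subset of \<open>'a\<close>.
  For infinite \<open>'a\<close> the type \<open>'a ord\<close> consists of the ordinals of cardinality at most that of
  \<open>'a\<close>, that is, of an initial segment of the class of all ordinals which is closed under all
  operations below (see \<open>ord_bounded\<close>). Every ordinal occurs in \<open>'a ord\<close> for \<open>'a\<close> large enough,
  so that statements about all ordinals are stated for arbitrary \<open>'a\<close>.
\<close>

quotient_type 'a ord = "'a rel" / partial: "\<lambda>r s. r =o s"
proof (rule part_equivpI)
  have "Well_order ({} :: 'a rel)" by simp
  then have "({} :: 'a rel) =o ({} :: 'a rel)" by (rule ordIso_reflexive)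
  then show "\<exists>r :: 'a rel. r =o r" by blast
qed (auto simp: symp_def transp_def intro: ordIso_symmetric ordIso_transitive)

instantiation ord :: (type) linorder
begin

lift_definition less_eq_ord :: "'a ord \<Rightarrow> 'a ord \<Rightarrow> bool" is "\<lambda>r s. r \<le>o s"
  by (meson ordIso_ordLeq_trans ordIso_symmetric ordLeq_ordIso_trans)

lift_definition less_ord :: "'a ord \<Rightarrow> 'a ord \<Rightarrow> bool" is "\<lambda>r s. r <o s"
  by (meson ordIso_ordLess_trans ordIso_symmetric ordLess_ordIso_trans)

instance
proof
  fix x y z :: "'a ord"
  show "(x < y) = (x \<le> y \<and> \<not> y \<le> x)"
  proof transfer
    fix x y :: "'a rel"
    assume "x =o x" "y =o y"
    then have "Well_order x" "Well_order y" by (simp_all add: ordIso_def)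
    then show "x <o y \<longleftrightarrow> x \<le>o y \<and> \<not> y \<le>o x"
      by (metis not_ordLeq_iff_ordLess ordLess_imp_ordLeq)
  qed
  show "x \<le> x" by transfer (rule ordIso_imp_ordLeq)
  show "x \<le> y \<Longrightarrow> y \<le> z \<Longrightarrow> x \<le> z" by transfer (rule ordLeq_transitive)
  show "x \<le> y \<Longrightarrow> y \<le> x \<Longrightarrow> x = y" by transfer (simp add: ordIso_iff_ordLeq)
  show "x \<le> y \<or> y \<le> x"
    by transfer (use ordLeq_total in \<open>auto simp: ordIso_def\<close>)
qed

end

lemma wf_less_ord: "wf {(x :: 'a ord, y). x < y}"
proof -
  have "{(x :: 'a ord, y). x < y} \<subseteq> inv_image ordLess rep_ord"
    by (auto simp: less_ord.rep_eq)
  then show ?thesis by (rule wf_subset[OF wf_inv_image[OF wf_ordLess]])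
qed

instance ord :: (type) wellorder
  by standard (use wf_less_ord in \<open>auto simp: wf_def\<close>)

lemma abs_ord_less: "r <o s \<Longrightarrow> abs_ord r < abs_ord s"
  by (subst less_ord.abs_eq) (auto intro!: ordIso_reflexive simp: ordLess_def)

lemma Well_order_rep_ord: "Well_order (rep_ord x)"
  using Quotient3_rep_reflp[OF Quotient3_ord, of x] by (simp add: ordIso_def)

lemma abs_rep_ord: "abs_ord (rep_ord x) = x"
  by (rule Quotient3_abs_rep[OF Quotient3_ord])

lemma strict_mono_Restr_underS:
  assumes "Well_order r" "(a, b) \<in> r" "a \<noteq> b"
  shows "Restr r (underS r a) <o Restr r (underS r b)"
proof -
  have wo: "wo_rel r" using assms(1) by (simp add: wo_rel_def)
  have "underS r a \<subset> underS r b"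
    using assms wo_rel.TRANS[OF wo] wo_rel.ANTISYM[OF wo]
    by (auto simp: underS_def trans_def antisym_def; blast)
  then show ?thesis
    using ofilter_subset_ordLess[OF assms(1)] wo_rel.underS_ofilter[OF wo] by blast
qed

lemma card_of_lessThan_ord: "|{..<x :: 'a ord}| \<le>o |UNIV :: 'a set|"
proof -
  let ?r = "rep_ord x"
  have "{..<x} \<subseteq> (\<lambda>a. abs_ord (Restr ?r (underS ?r a))) ` UNIV"
  proof
    fix y assume "y \<in> {..<x}"
    then have "rep_ord y <o ?r" by (simp add: less_ord.rep_eq)
    then obtain a where "rep_ord y =o Restr ?r (underS ?r a)"
      unfolding ordLess_iff_ordIso_Restr[OF Well_order_rep_ord Well_order_rep_ord] ..
    then have "y = abs_ord (Restr ?r (underS ?r a))"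
      using Quotient3_rel_abs[OF Quotient3_ord, of "rep_ord y"] by (simp add: abs_rep_ord)
    then show "y \<in> (\<lambda>a. abs_ord (Restr ?r (underS ?r a))) ` UNIV" by blast
  qed
  then show ?thesis by (rule surj_imp_ordLeq)
qed

lemma ord_bounded:
  fixes A :: "'a::infinite ord set"
  assumes A: "|A| \<le>o |UNIV :: 'a set|"
  shows "\<exists>b. \<forall>a\<in>A. a < b"
proof (rule ccontr)
  assume "\<not> ?thesis"
  then have "(\<Union>a\<in>A. {..<a} \<union> {a}) = UNIV"
    by (auto simp: not_less le_less)
  moreover have "|\<Union>a\<in>A. {..<a} \<union> {a}| \<le>o |UNIV :: 'a set|"
  proof (intro card_of_UNION_ordLeq_infinite ballI A infinite_UNIV)
    fix a :: "'a ord"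
    have "|{a}| \<le>o |UNIV :: 'a set|" by (rule card_of_singl_ordLeq) simp
    then show "|{..<a} \<union> {a}| \<le>o |UNIV :: 'a set|"
      by (intro card_of_Un_ordLeq_infinite_Field card_of_lessThan_ord card_of_Card_order)
        (simp_all add: infinite_UNIV Field_card_of)
  qed
  ultimately obtain g :: "'a ord \<Rightarrow> 'a" where g: "inj g"
    using card_of_ordLeq[of "UNIV :: 'a ord set" "UNIV :: 'a set"] by auto
  define R where "R = {(x :: 'a ord, y). x \<le> y}"
  define r where "r = dir_image R g"
  have "Well_order R"
  proof -
    have "R - Id = {(x, y). x < y}" by (auto simp: R_def)
    moreover have "Field R = UNIV" by (auto simp: R_def Field_def)
    ultimately show ?thesis
      using wf_less_ord
      by (auto simp: order_on_defs R_def refl_on_def trans_def antisym_def total_on_def)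
  qed
  then have r: "Well_order r" unfolding r_def
    by (rule Well_order_dir_image) (use g in \<open>auto intro: inj_on_subset\<close>)
  have gr: "(g x, g y) \<in> r" if "x \<le> y" for x y
    using that by (auto simp: r_def R_def dir_image_def)
  define t where "t x = abs_ord (Restr r (underS r (g x)))" for x
  have t_mono: "t x < t y" if "x < y" for x y
    unfolding t_def
    by (intro abs_ord_less strict_mono_Restr_underS r gr)
      (use that g in \<open>auto simp: inj_def\<close>)
  have le_t: "x \<le> t x" for x
  proof (induction x rule: less_induct)
    case (less x)
    show ?case
    proof (rule ccontr)
      assume "\<not> x \<le> t x"
      then have "t (t x) < t x" "t x \<le> t (t x)" using t_mono less by auto
      then show False by simp
    qed
  qed
  have "t x < abs_ord r" for x
    unfolding t_def
    using r gr[of x x] by (intro abs_ord_less underS_Restr_ordLess) (auto simp: Field_def)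
  from this[of "abs_ord r"] le_t[of "abs_ord r"] show False by simp
qed

lemma bounded_image_lessThan_ord:
  fixes f :: "'a::infinite ord \<Rightarrow> 'a ord"
  shows "\<exists>b. \<forall>x<a. f x < b"
proof -
  have "|f ` {..<a}| \<le>o |UNIV :: 'a set|"
    using card_of_image card_of_lessThan_ord ordLeq_transitive by blast
  from ord_bounded[OF this] show ?thesis by blast
qed

instance ord :: (infinite) no_top
proof
  fix x :: "'a ord"
  show "\<exists>y. x < y"
    using ord_bounded[of "{x}"] card_of_singl_ordLeq[of "UNIV :: 'a set" x] by auto
qed

unbundle no cardinal_syntax


section \<open>Ordinal arithmetic\<close>

instantiation ord :: (type) "{zero, one}"
begin

definition zero_ord :: "'a ord" where "zero_ord = (LEAST x. True)"

definition one_ord :: "'a ord" where "one_ord = (LEAST x. 0 < x)"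

instance ..

end

instantiation ord :: (type) "{plus, times}"
begin

function plus_ord :: "'a ord \<Rightarrow> 'a ord \<Rightarrow> 'a ord" where
  "plus_ord \<alpha> \<beta> = (LEAST \<gamma>. \<alpha> \<le> \<gamma> \<and> (\<forall>\<delta>\<in>{..<\<beta>}. plus_ord \<alpha> \<delta> < \<gamma>))"
  by auto
termination
  by (relation "inv_image {(x, y). x < y} snd")
    (auto simp: wf_less_ord)

declare plus_ord.simps [simp del]

function times_ord :: "'a ord \<Rightarrow> 'a ord \<Rightarrow> 'a ord" where
  "times_ord \<alpha> \<beta> = (LEAST \<gamma>. \<forall>\<delta>\<in>{..<\<beta>}. times_ord \<alpha> \<delta> + \<alpha> \<le> \<gamma>)"
  by auto
termination
  by (relation "inv_image {(x, y). x < y} snd")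
    (auto simp: wf_less_ord)

declare times_ord.simps [simp del]

instance ..

end

text \<open>With this, \<open>\<alpha> dvd \<beta>\<close> means \<open>\<exists>\<delta>. \<beta> = \<alpha> * \<delta>\<close>.\<close>

instance ord :: (type) Rings.dvd ..

lemma zero_le_ord [simp]: "(0 :: 'a ord) \<le> x"
  unfolding zero_ord_def by (rule Least_le) simp

lemma not_less_zero_ord [simp]: "\<not> x < (0 :: 'a ord)"
  by (simp add: not_less)

lemma less_one_ord_iff: "(x :: 'a::infinite ord) < 1 \<longleftrightarrow> x = 0"
proof -
  have "(0 :: 'a ord) < 1"
    unfolding one_ord_def by (rule LeastI_ex) (rule gt_ex)
  moreover have "x = 0" if "x < 1"
    using not_less_Least[OF that[unfolded one_ord_def]] by (simp add: antisym not_less)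
  ultimately show ?thesis by auto
qed

text \<open>
  The least upper bounds in the definitions of the operations exist, so the operations satisfy
  the usual recursions.
\<close>

lemma add_ord_le_iff:
  "(\<alpha> :: 'a::infinite ord) + \<beta> \<le> \<gamma> \<longleftrightarrow> \<alpha> \<le> \<gamma> \<and> (\<forall>\<delta><\<beta>. \<alpha> + \<delta> < \<gamma>)"
proof -
  let ?P = "\<lambda>\<gamma>. \<alpha> \<le> \<gamma> \<and> (\<forall>\<delta>\<in>{..<\<beta>}. \<alpha> + \<delta> < \<gamma>)"
  obtain b where "\<forall>\<delta><\<beta>. \<alpha> + \<delta> < b"
    using bounded_image_lessThan_ord[of \<beta> "\<lambda>\<delta>. \<alpha> + \<delta>"] by blast
  then have "?P (max \<alpha> b)" by (auto simp: less_max_iff_disj)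
  then have "?P (\<alpha> + \<beta>)" unfolding plus_ord.simps[of \<alpha> \<beta>] by (rule LeastI)
  moreover have "\<alpha> + \<beta> \<le> \<gamma>" if "?P \<gamma>" for \<gamma>
    using that unfolding plus_ord.simps[of \<alpha> \<beta>] by (rule Least_le)
  ultimately show ?thesis by (auto intro: less_le_trans order_trans)
qed

lemma mult_ord_le_iff:
  "(\<alpha> :: 'a::infinite ord) * \<beta> \<le> \<gamma> \<longleftrightarrow> (\<forall>\<delta><\<beta>. \<alpha> * \<delta> + \<alpha> \<le> \<gamma>)"
proof -
  let ?P = "\<lambda>\<gamma>. \<forall>\<delta>\<in>{..<\<beta>}. \<alpha> * \<delta> + \<alpha> \<le> \<gamma>"
  obtain b where "\<forall>\<delta><\<beta>. \<alpha> * \<delta> + \<alpha> < b"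
    using bounded_image_lessThan_ord[of \<beta> "\<lambda>\<delta>. \<alpha> * \<delta> + \<alpha>"] by blast
  then have "?P b" by auto
  then have "?P (\<alpha> * \<beta>)" unfolding times_ord.simps[of \<alpha> \<beta>] by (rule LeastI)
  moreover have "\<alpha> * \<beta> \<le> \<gamma>" if "?P \<gamma>" for \<gamma>
    using that unfolding times_ord.simps[of \<alpha> \<beta>] by (rule Least_le)
  ultimately show ?thesis by (auto intro: order_trans)
qed

lemma add_ord_zero_right [simp]: "(\<alpha> :: 'a::infinite ord) + 0 = \<alpha>"
  by (rule antisym) (use add_ord_le_iff[of \<alpha> 0] in auto)

lemma mult_ord_zero_right [simp]: "(\<alpha> :: 'a::infinite ord) * 0 = 0"
  by (rule antisym) (use mult_ord_le_iff[of \<alpha> 0] in auto)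

lemma le_add_ord [simp]: "(\<alpha> :: 'a::infinite ord) \<le> \<alpha> + \<beta>"
  using add_ord_le_iff[of \<alpha> \<beta>] by blast

lemma add_ord_strict_mono: "\<beta> < \<gamma> \<Longrightarrow> (\<alpha> :: 'a::infinite ord) + \<beta> < \<alpha> + \<gamma>"
  using add_ord_le_iff[of \<alpha> \<gamma>] by blast

lemma add_ord_less_cancel [simp]:
  "(\<alpha> :: 'a::infinite ord) + \<beta> < \<alpha> + \<gamma> \<longleftrightarrow> \<beta> < \<gamma>"
  by (metis add_ord_strict_mono less_asym linorder_less_linear less_irrefl)

lemma add_ord_cancel [simp]: "(\<alpha> :: 'a::infinite ord) + \<beta> = \<alpha> + \<gamma> \<longleftrightarrow> \<beta> = \<gamma>"
  by (metis add_ord_strict_mono linorder_less_linear less_irrefl)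

text \<open>\<open>\<alpha> + 1\<close> is the successor of \<open>\<alpha>\<close>.\<close>

lemma add_one_ord_le_iff: "(\<alpha> :: 'a::infinite ord) + 1 \<le> \<beta> \<longleftrightarrow> \<alpha> < \<beta>"
  by (auto simp: add_ord_le_iff less_one_ord_iff)

lemma less_add_one_ord_iff: "\<beta> < (\<alpha> :: 'a::infinite ord) + 1 \<longleftrightarrow> \<beta> \<le> \<alpha>"
  by (meson add_one_ord_le_iff not_le)

lemma mult_ord_add_one: "(\<alpha> :: 'a::infinite ord) * (\<beta> + 1) = \<alpha> * \<beta> + \<alpha>"
proof (rule antisym)
  have "\<alpha> * \<delta> + \<alpha> \<le> \<alpha> * \<beta> + \<alpha>" if "\<delta> \<le> \<beta>" for \<delta>
  proof (cases "\<delta> = \<beta>")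
    case False
    then have "\<alpha> * \<delta> + \<alpha> \<le> \<alpha> * \<beta>"
      using that mult_ord_le_iff[of \<alpha> \<beta> "\<alpha> * \<beta>"] by auto
    then show ?thesis by (rule order_trans) simp
  qed simp
  then show "\<alpha> * (\<beta> + 1) \<le> \<alpha> * \<beta> + \<alpha>"
    by (simp add: mult_ord_le_iff[of \<alpha> "\<beta> + 1"] less_add_one_ord_iff)
  show "\<alpha> * \<beta> + \<alpha> \<le> \<alpha> * (\<beta> + 1)"
    using mult_ord_le_iff[of \<alpha> "\<beta> + 1" "\<alpha> * (\<beta> + 1)"] by (simp add: less_add_one_ord_iff)
qed

text \<open>Quotient and remainder of the division by \<open>\<rho>\<close> are unique.\<close>

lemma ord_division_unique:
  fixes \<rho> :: "'a::infinite ord"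
  assumes "\<rho> * \<zeta> + \<epsilon> = \<rho> * \<zeta>' + \<epsilon>'" "\<epsilon> < \<rho>" "\<epsilon>' < \<rho>"
  shows "\<zeta> = \<zeta>'" "\<epsilon> = \<epsilon>'"
proof -
  have *: "\<rho> * x + e < \<rho> * y + e'" if "x < y" "e < \<rho>" for x y e e' :: "'a ord"
  proof -
    have "\<rho> * x + e < \<rho> * x + \<rho>" using that by simp
    also have "\<dots> \<le> \<rho> * y" using that mult_ord_le_iff[of \<rho> y "\<rho> * y"] by auto
    also have "\<dots> \<le> \<rho> * y + e'" by simp
    finally show ?thesis .
  qed
  show "\<zeta> = \<zeta>'"
    using *[of \<zeta> \<zeta>' \<epsilon> \<epsilon>'] *[of \<zeta>' \<zeta> \<epsilon>' \<epsilon>] assms by (metis linorder_less_linear less_irrefl)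
  then show "\<epsilon> = \<epsilon>'" using assms by simp
qed

definition indecomposable :: "'a ord \<Rightarrow> bool" where
  "indecomposable \<rho> \<longleftrightarrow> \<rho> \<noteq> 0 \<and> (\<forall>x<\<rho>. \<forall>y<\<rho>. x + y < \<rho>)"


section \<open>The relations\<close>

text \<open>\<open>f_op \<rho> \<xi>\<close> is the function \<open>f\<^sub>\<xi>\<close>; see \<open>f_op_mult\<close> and \<open>f_op_mult_add\<close> for its values.\<close>

definition f_op :: "'a ord \<Rightarrow> 'a ord \<Rightarrow> 'a ord \<Rightarrow> 'a ord" where
  "f_op \<rho> \<xi> \<beta> =
    (if \<rho> dvd \<beta> then \<beta> + \<xi>
     else (THE \<sigma>. \<rho> dvd \<sigma> \<and> (\<exists>\<epsilon>. 0 < \<epsilon> \<and> \<epsilon> < \<rho> \<and> \<beta> = \<sigma> + \<epsilon>)))"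

lemma f_op_mult: "f_op \<rho> \<xi> (\<rho> * \<zeta>) = \<rho> * \<zeta> + \<xi>"
  by (auto simp: f_op_def dvd_def)

lemma f_op_mult_add:
  fixes \<rho> :: "'a::infinite ord"
  assumes "0 < \<epsilon>" "\<epsilon> < \<rho>"
  shows "f_op \<rho> \<xi> (\<rho> * \<zeta> + \<epsilon>) = \<rho> * \<zeta>"
proof -
  have "\<not> \<rho> dvd \<rho> * \<zeta> + \<epsilon>"
  proof
    assume "\<rho> dvd \<rho> * \<zeta> + \<epsilon>"
    then obtain \<zeta>' where "\<rho> * \<zeta> + \<epsilon> = \<rho> * \<zeta>' + 0" by (auto simp: dvd_def)
    then show False using ord_division_unique(2)[of \<rho> \<zeta> \<epsilon> \<zeta>' 0] assms
      by (metis less_irrefl order.strict_trans)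
  qed
  moreover have "(THE \<sigma>. \<rho> dvd \<sigma> \<and> (\<exists>\<epsilon>'. 0 < \<epsilon>' \<and> \<epsilon>' < \<rho> \<and> \<rho> * \<zeta> + \<epsilon> = \<sigma> + \<epsilon>')) = \<rho> * \<zeta>"
  proof (rule the_equality)
    show "\<rho> dvd \<rho> * \<zeta> \<and> (\<exists>\<epsilon>'. 0 < \<epsilon>' \<and> \<epsilon>' < \<rho> \<and> \<rho> * \<zeta> + \<epsilon> = \<rho> * \<zeta> + \<epsilon>')"
      using assms by (auto simp: dvd_def)
    fix \<sigma>
    assume "\<rho> dvd \<sigma> \<and> (\<exists>\<epsilon>'. 0 < \<epsilon>' \<and> \<epsilon>' < \<rho> \<and> \<rho> * \<zeta> + \<epsilon> = \<sigma> + \<epsilon>')"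
    then obtain \<zeta>' \<epsilon>' where
      *: "\<sigma> = \<rho> * \<zeta>'" "\<rho> * \<zeta> + \<epsilon> = \<rho> * \<zeta>' + \<epsilon>'" "\<epsilon>' < \<rho>"
      unfolding dvd_def by blast
    show "\<sigma> = \<rho> * \<zeta>"
      using ord_division_unique(1)[OF *(2) assms(2) *(3)] *(1) by simp
  qed
  ultimately show ?thesis by (simp add: f_op_def)
qed

definition closed_set :: "'a ord \<Rightarrow> 'a ord set \<Rightarrow> bool" where
  "closed_set \<rho> X \<longleftrightarrow> (\<forall>\<sigma>. \<rho> dvd \<sigma> \<and> (\<exists>\<xi><\<rho>. \<sigma> + \<xi> \<in> X) \<longrightarrow> \<sigma> \<in> X)"

definition set_less :: "'a ord set \<Rightarrow> 'a ord set \<Rightarrow> bool" where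
  "set_less X Y \<longleftrightarrow> (\<forall>x\<in>X. \<forall>y\<in>Y. x < y)"

text \<open>
  The following notions are parametrized by a family \<open>L\<close> of relations, in which \<open>L k\<close> stands for
  \<open>\<le>\<^sub>k\<close> (\<open>k = 1, 2\<close>).
\<close>

definition covering ::
    "'a ord \<Rightarrow> (nat \<Rightarrow> 'a ord \<Rightarrow> 'a ord \<Rightarrow> bool) \<Rightarrow> 'a ord set \<Rightarrow> ('a ord \<Rightarrow> 'a ord) \<Rightarrow> bool" where
  "covering \<rho> L X h \<longleftrightarrow>
    strict_mono_on X h \<and>
    (\<forall>x\<in>X. \<forall>y\<in>X.
      (\<forall>\<xi><\<rho>. f_op \<rho> \<xi> x = y \<longleftrightarrow> f_op \<rho> \<xi> (h x) = h y) \<and>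
      (\<forall>k\<in>{1, 2}. L k x y \<longrightarrow> L k (h x) (h y)))"

definition is_covering_of ::
    "'a ord \<Rightarrow> (nat \<Rightarrow> 'a ord \<Rightarrow> 'a ord \<Rightarrow> bool) \<Rightarrow> 'a ord set \<Rightarrow> 'a ord set \<Rightarrow> bool" where
  "is_covering_of \<rho> L Z X \<longleftrightarrow> (\<exists>h. covering \<rho> L X h \<and> Z = h ` X)"

definition cofinally_many :: "'a ord \<Rightarrow> ('a ord set \<Rightarrow> bool) \<Rightarrow> bool" where
  "cofinally_many \<alpha> P \<longleftrightarrow> (\<forall>\<gamma><\<alpha>. \<exists>Y'. finite Y' \<and> Y' \<subseteq> {\<gamma><..<\<alpha>} \<and> P Y')"

definition le1_cond ::
    "'a ord \<Rightarrow> (nat \<Rightarrow> 'a ord \<Rightarrow> 'a ord \<Rightarrow> bool) \<Rightarrow> 'a ord \<Rightarrow> 'a ord \<Rightarrow> bool" where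
  "le1_cond \<rho> L \<alpha> \<beta> \<longleftrightarrow>
    \<alpha> \<le> \<beta> \<and>
    (\<forall>X Y. finite X \<and> X \<subseteq> {..<\<alpha>} \<and> finite Y \<and> Y \<subseteq> {\<alpha>..<\<beta>} \<and> closed_set \<rho> (X \<union> Y) \<longrightarrow>
      (\<exists>Y'. finite Y' \<and> Y' \<subseteq> {..<\<alpha>} \<and> set_less X Y' \<and>
        is_covering_of \<rho> L (X \<union> Y') (X \<union> Y)))"

definition le2_up ::
    "'a ord \<Rightarrow> (nat \<Rightarrow> 'a ord \<Rightarrow> 'a ord \<Rightarrow> bool) \<Rightarrow> 'a ord \<Rightarrow> 'a ord \<Rightarrow> bool" where
  "le2_up \<rho> L \<alpha> \<beta> \<longleftrightarrow>
    (\<forall>X Y. finite X \<and> X \<subseteq> {..<\<alpha>} \<and> finite Y \<and> Y \<subseteq> {..<\<alpha>} \<and> closed_set \<rho> (X \<union> Y) \<and>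
        set_less X Y \<longrightarrow>
      cofinally_many \<alpha> (\<lambda>Y'. is_covering_of \<rho> L (X \<union> Y') (X \<union> Y)) \<longrightarrow>
      cofinally_many \<beta> (\<lambda>Y'. is_covering_of \<rho> L (X \<union> Y') (X \<union> Y)))"

definition le2_down ::
    "'a ord \<Rightarrow> (nat \<Rightarrow> 'a ord \<Rightarrow> 'a ord \<Rightarrow> bool) \<Rightarrow> 'a ord \<Rightarrow> 'a ord \<Rightarrow> bool" where
  "le2_down \<rho> L \<alpha> \<beta> \<longleftrightarrow>
    (\<forall>X Y. finite X \<and> X \<subseteq> {..<\<alpha>} \<and> finite Y \<and> Y \<subseteq> {\<alpha>..<\<beta>} \<and> closed_set \<rho> (X \<union> Y) \<longrightarrow>
      (\<exists>Y'. finite Y' \<and> Y' \<subseteq> {..<\<alpha>} \<and> set_less X Y' \<and>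
        is_covering_of \<rho> L (X \<union> Y') (X \<union> Y) \<and>
        (\<forall>i<card Y. L 1 (sorted_list_of_set Y ! i) \<beta> \<longrightarrow>
          L 1 (sorted_list_of_set Y' ! i) \<alpha>)))"

definition le2_cond ::
    "'a ord \<Rightarrow> (nat \<Rightarrow> 'a ord \<Rightarrow> 'a ord \<Rightarrow> bool) \<Rightarrow> 'a ord \<Rightarrow> 'a ord \<Rightarrow> bool" where
  "le2_cond \<rho> L \<alpha> \<beta> \<longleftrightarrow> \<alpha> \<le> \<beta> \<and> le2_up \<rho> L \<alpha> \<beta> \<and> le2_down \<rho> L \<alpha> \<beta>"

text \<open>
  \<open>le \<rho> k \<alpha> \<beta>\<close> is \<open>\<alpha> \<le>\<^sub>k \<beta>\<close> for \<open>k = 1, 2\<close> (and false for other \<open>k\<close>). It is defined by recursion on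
  \<open>\<beta>\<close>, and for fixed \<open>\<beta>\<close> on \<open>k\<close>, since the clause for \<open>\<le>\<^sub>2\<close> refers to \<open>\<le>\<^sub>1\<close> with the same larger
  argument. The lemmas \<open>le_1_iff\<close> and \<open>le_2_iff\<close> are the resulting recursive clauses.
\<close>

definition le_rel :: "'a ord \<Rightarrow> 'a ord \<times> nat \<Rightarrow> 'a ord \<Rightarrow> bool" where
  "le_rel \<rho> = wfrec ({(x, y). x < y} <*lex*> less_than)
    (\<lambda>F (\<beta>, k) \<alpha>.
      let L = (\<lambda>j x y. F (y, j) x)
      in if k = 1 then le1_cond \<rho> L \<alpha> \<beta> else if k = 2 then le2_cond \<rho> L \<alpha> \<beta> else False)"

definition le :: "'a ord \<Rightarrow> nat \<Rightarrow> 'a ord \<Rightarrow> 'a ord \<Rightarrow> bool" where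
  "le \<rho> k \<alpha> \<beta> \<longleftrightarrow> le_rel \<rho> (\<beta>, k) \<alpha>"

lemma is_covering_of_cong:
  assumes "Z \<subseteq> {..<\<beta>}" "X \<subseteq> {..<\<beta>}"
    and "\<And>k x y. k \<in> {1, 2} \<Longrightarrow> y < \<beta> \<Longrightarrow> L k x y = L' k x y"
  shows "is_covering_of \<rho> L Z X = is_covering_of \<rho> L' Z X"
proof -
  have *: "is_covering_of \<rho> L' Z X"
    if cov: "is_covering_of \<rho> L Z X"
      and L: "\<And>k x y. k \<in> {1, 2} \<Longrightarrow> y < \<beta> \<Longrightarrow> L k x y = L' k x y"
    for L L' :: "nat \<Rightarrow> 'a ord \<Rightarrow> 'a ord \<Rightarrow> bool"
  proof -
    obtain h where h: "covering \<rho> L X h" "Z = h ` X"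
      using cov by (auto simp: is_covering_of_def)
    have "L k x y = L' k x y" "L k (h x) (h y) = L' k (h x) (h y)"
      if "k \<in> {1, 2}" "y \<in> X" for k x y
      using that assms(1,2) h(2) by (auto intro!: L)
    then have "covering \<rho> L' X h"
      using h(1) unfolding covering_def by blast
    then show ?thesis using h(2) by (auto simp: is_covering_of_def)
  qed
  show ?thesis using *[of L L'] *[of L' L] assms(3) by blast
qed

lemma le1_cond_cong:
  assumes L: "\<And>k x y. k \<in> {1, 2} \<Longrightarrow> y < \<beta> \<Longrightarrow> L k x y = L' k x y"
  shows "le1_cond \<rho> L \<alpha> \<beta> = le1_cond \<rho> L' \<alpha> \<beta>"
proof (cases "\<alpha> \<le> \<beta>")
  case True
  then have "is_covering_of \<rho> L (X \<union> Y') (X \<union> Y) = is_covering_of \<rho> L' (X \<union> Y') (X \<union> Y)"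
    if "X \<subseteq> {..<\<alpha>}" "Y \<subseteq> {\<alpha>..<\<beta>}" "Y' \<subseteq> {..<\<alpha>}" for X Y Y'
    using that by (intro is_covering_of_cong[where \<beta> = \<beta>] L) fastforce+
  then show ?thesis
    unfolding le1_cond_def
    by (intro conj_cong refl all_cong1 imp_cong ex_cong1) simp_all
qed (simp add: le1_cond_def)

lemma le2_cond_cong:
  assumes L: "\<And>k x y. k \<in> {1, 2} \<Longrightarrow> y < \<beta> \<Longrightarrow> L k x y = L' k x y"
    and L1: "\<And>x. L 1 x \<beta> = L' 1 x \<beta>"
  shows "le2_cond \<rho> L \<alpha> \<beta> = le2_cond \<rho> L' \<alpha> \<beta>"
proof (cases "\<alpha> \<le> \<beta>")
  case True
  have cov: "is_covering_of \<rho> L (X \<union> Y') (X \<union> Y) = is_covering_of \<rho> L' (X \<union> Y') (X \<union> Y)"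
    if "X \<subseteq> {..<\<beta>}" "Y \<subseteq> {..<\<beta>}" "Y' \<subseteq> {..<\<beta>}" for X Y Y'
    using that by (intro is_covering_of_cong[where \<beta> = \<beta>] L) auto
  have cof: "cofinally_many \<delta> (\<lambda>Y'. is_covering_of \<rho> L (X \<union> Y') (X \<union> Y)) =
      cofinally_many \<delta> (\<lambda>Y'. is_covering_of \<rho> L' (X \<union> Y') (X \<union> Y))"
    if "X \<subseteq> {..<\<alpha>}" "Y \<subseteq> {..<\<alpha>}" "\<delta> \<le> \<beta>" for X Y \<delta>
    unfolding cofinally_many_def
    by (intro all_cong1 imp_cong ex_cong1 conj_cong refl cov)
      (use that True in fastforce)+
  have "L 1 x \<alpha> = L' 1 x \<alpha>" for x
    using True L L1 by (cases "\<alpha> = \<beta>") auto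
  then have "le2_down \<rho> L \<alpha> \<beta> = le2_down \<rho> L' \<alpha> \<beta>"
    unfolding le2_down_def L1
    by (intro all_cong1 imp_cong ex_cong1 conj_cong refl cov)
      (use True in fastforce)+
  moreover have "le2_up \<rho> L \<alpha> \<beta> = le2_up \<rho> L' \<alpha> \<beta>"
    unfolding le2_up_def using True
    by (intro all_cong1 imp_cong refl cof) auto
  ultimately show ?thesis by (simp add: le2_cond_def)
qed (simp add: le2_cond_def)

lemma le_unfold:
  "le \<rho> k \<alpha> \<beta> \<longleftrightarrow> k = 1 \<and> le1_cond \<rho> (le \<rho>) \<alpha> \<beta> \<or> k = 2 \<and> le2_cond \<rho> (le \<rho>) \<alpha> \<beta>"
proof -
  let ?R = "{(x :: 'a ord, y). x < y} <*lex*> less_than"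
  have wf: "wf ?R" by (intro wf_lex_prod wf_less_ord wf_less_than)
  define L where "L = (\<lambda>j x y. cut (le_rel \<rho>) ?R (\<beta>, k) (y, j) x)"
  have L: "L j x y = le \<rho> j x y" if "y < \<beta> \<or> y = \<beta> \<and> j < k" for j x y
    using that by (auto simp: L_def le_def cut_def)
  have "le \<rho> k \<alpha> \<beta> =
      (if k = 1 then le1_cond \<rho> L \<alpha> \<beta> else if k = 2 then le2_cond \<rho> L \<alpha> \<beta> else False)"
    unfolding le_def L_def using wf
    by (subst le_rel_def, subst wfrec) (simp_all add: Let_def le_rel_def)
  moreover have "le1_cond \<rho> L \<alpha> \<beta> = le1_cond \<rho> (le \<rho>) \<alpha> \<beta>"
    by (rule le1_cond_cong) (simp add: L)
  moreover have "le2_cond \<rho> L \<alpha> \<beta> = le2_cond \<rho> (le \<rho>) \<alpha> \<beta>" if "k = 2"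
    by (rule le2_cond_cong) (use that in \<open>simp_all add: L\<close>)
  ultimately show ?thesis by auto
qed

lemma le_1_iff: "le \<rho> 1 \<alpha> \<beta> \<longleftrightarrow> le1_cond \<rho> (le \<rho>) \<alpha> \<beta>"
  by (subst le_unfold) simp

lemma le_2_iff: "le \<rho> 2 \<alpha> \<beta> \<longleftrightarrow> le2_cond \<rho> (le \<rho>) \<alpha> \<beta>"
  by (subst le_unfold) simp

definition not_le_sets :: "'a ord \<Rightarrow> nat \<Rightarrow> 'a ord set \<Rightarrow> 'a ord set \<Rightarrow> bool" where
  "not_le_sets \<rho> k A B \<longleftrightarrow> (\<forall>a\<in>A. \<forall>b\<in>B. \<not> le \<rho> k a b)"

definition isomorphic :: "'a ord \<Rightarrow> 'a ord set \<Rightarrow> 'a ord set \<Rightarrow> bool" where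
  "isomorphic \<rho> A B \<longleftrightarrow>
    (\<exists>h. bij_betw h A B \<and> strict_mono_on A h \<and>
      (\<forall>x\<in>A. \<forall>y\<in>A.
        (\<forall>\<xi><\<rho>. f_op \<rho> \<xi> x = y \<longleftrightarrow> f_op \<rho> \<xi> (h x) = h y) \<and>
        (\<forall>k\<in>{1, 2}. le \<rho> k x y \<longleftrightarrow> le \<rho> k (h x) (h y))))"

end

theory Submission
  imports Defs
begin

text \<open>
  Write \<open>\<alpha> = \<rho> * \<zeta> + \<epsilon>\<close> with \<open>0 < \<epsilon> < \<rho>\<close>; the isomorphism is \<open>1 + \<delta> \<mapsto> \<alpha> + \<delta>\<close>. An ordinal not divisible
  by \<open>\<rho>\<close> is related only to itself, since reflecting it over the base of its block would have to fix
  it. So only the parts from \<open>p = \<rho>\<close> and \<open>q = \<rho> * \<zeta> + \<rho>\<close> on matter, where the isomorphism is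
  \<open>p + c \<mapsto> q + c\<close>, and both relations are transferred by induction on the larger argument, with the
  roles of \<open>p\<close> and \<open>q\<close> symmetric. To reflect above \<open>q\<close>, one reflects above \<open>p\<close> after adding the
  predecessor of \<open>p\<close> among the multiples of \<open>\<rho>\<close> to \<open>X\<close>; this keeps the reflected elements above
  \<open>p\<close>. The elements of \<open>X\<close> below \<open>q\<close> are left fixed: by hypothesis they have no \<open>\<le>\<^sub>2\<close> relations
  to elements above \<open>q\<close>, and their \<open>\<le>\<^sub>1\<close> relations persist since \<open>\<le>\<^sub>1\<close> is inherited by smaller
  right arguments. In the upward clause of \<open>\<le>\<^sub>2\<close> the set \<open>Y\<close> is first moved above \<open>q\<close>.
\<close>

section \<open>Ordinal arithmetic\<close>

lemma ord_zero_less_iff: "0 < (x :: 'a ord) \<longleftrightarrow> x \<noteq> 0"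
  using antisym[OF _ zero_le_ord, of x] by (auto simp: not_less[symmetric])

text \<open>If \<open>\<alpha> + \<beta> < \<beta>\<close>, the induction hypothesis at
  \<open>\<alpha> + \<beta>\<close> contradicts strict monotonicity of addition in its right
  argument.\<close>

lemma le_add_ord_left: "(\<beta> :: 'a::infinite ord) \<le> \<alpha> + \<beta>"
proof (induction \<beta> rule: less_induct)
  case (less \<beta>)
  show ?case
  proof (rule ccontr)
    assume "\<not> \<beta> \<le> \<alpha> + \<beta>"
    then have *: "\<alpha> + \<beta> < \<beta>" by simp
    with less have "\<alpha> + \<beta> \<le> \<alpha> + (\<alpha> + \<beta>)" by blast
    with * show False by (metis add_ord_less_cancel not_less)
  qed
qed

lemma add_ord_zero_left [simp]: "0 + (x :: 'a::infinite ord) = x"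
proof (induction x rule: less_induct)
  case (less x)
  then show ?case by (intro antisym le_add_ord_left) (simp add: add_ord_le_iff[of 0 x])
qed

text \<open>Left subtraction: the difference is the least \<open>\<gamma>\<close> with
  \<open>\<beta> \<le> \<alpha> + \<gamma>\<close>. By leastness every
  \<open>\<alpha> + \<delta>\<close> with \<open>\<delta> < \<gamma>\<close> is below
  \<open>\<beta>\<close>, so \<open>\<alpha> + \<gamma>\<close> does not exceed
  \<open>\<beta>\<close>.\<close>

lemma ord_diff_ex: "(\<alpha> :: 'a::infinite ord) \<le> \<beta> \<Longrightarrow> \<exists>\<gamma>. \<beta> = \<alpha> + \<gamma>"
proof -
  assume le: "\<alpha> \<le> \<beta>"
  define \<gamma> where "\<gamma> = (LEAST \<gamma>. \<beta> \<le> \<alpha> + \<gamma>)"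
  have "\<beta> \<le> \<alpha> + \<gamma>" unfolding \<gamma>_def by (rule LeastI) (rule le_add_ord_left)
  moreover have "\<alpha> + \<gamma> \<le> \<beta>"
    using le not_less_Least[of _ "\<lambda>\<gamma>. \<beta> \<le> \<alpha> + \<gamma>", folded \<gamma>_def]
    by (auto simp: add_ord_le_iff not_le)
  ultimately show ?thesis by (auto intro: antisym)
qed

lemma less_add_ord_iff:
  "\<delta> < (\<alpha> :: 'a::infinite ord) + \<beta> \<longleftrightarrow> \<delta> < \<alpha> \<or> (\<exists>\<gamma><\<beta>. \<delta> = \<alpha> + \<gamma>)"
  by (metis add_ord_less_cancel le_add_ord less_le_trans not_le ord_diff_ex)

text \<open>Both sides have the same upper bounds, since an ordinal below
  \<open>\<beta> + \<gamma>\<close> is either below \<open>\<beta>\<close> or a sum of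
  \<open>\<beta>\<close> and something below \<open>\<gamma>\<close>.\<close>

lemma add_ord_assoc: "(\<alpha> :: 'a::infinite ord) + \<beta> + \<gamma> = \<alpha> + (\<beta> + \<gamma>)"
proof (induction \<gamma> rule: less_induct)
  case (less \<gamma>)
  have "\<alpha> + \<beta> + \<gamma> \<le> x \<longleftrightarrow> \<alpha> + (\<beta> + \<gamma>) \<le> x" for x
    using less
    by (auto simp: add_ord_le_iff[of "\<alpha> + \<beta>" \<gamma>] add_ord_le_iff[of \<alpha> "\<beta> + \<gamma>"] less_add_ord_iff
        add_ord_le_iff[of \<alpha> \<beta>])
  then show ?case by (meson antisym order_refl)
qed

lemma mult_add_one_le:
  "\<zeta> < \<eta> \<Longrightarrow> (\<rho> :: 'a::infinite ord) * \<zeta> + \<rho> \<le> \<rho> * \<eta>"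
  using mult_ord_le_iff[of \<rho> \<eta> "\<rho> * \<eta>"] by auto

lemma mult_add_ord: "(\<rho> :: 'a::infinite ord) * (\<alpha> + \<beta>) = \<rho> * \<alpha> + \<rho> * \<beta>"
proof (induction \<beta> rule: less_induct)
  case (less \<beta>)
  show ?case
  proof (rule antisym)
    show "\<rho> * (\<alpha> + \<beta>) \<le> \<rho> * \<alpha> + \<rho> * \<beta>"
      unfolding mult_ord_le_iff[of \<rho> "\<alpha> + \<beta>"]
    proof (intro allI impI)
      fix \<delta> assume "\<delta> < \<alpha> + \<beta>"
      then consider "\<delta> < \<alpha>" | \<gamma> where "\<gamma> < \<beta>" "\<delta> = \<alpha> + \<gamma>"
        by (auto simp: less_add_ord_iff)
      then show "\<rho> * \<delta> + \<rho> \<le> \<rho> * \<alpha> + \<rho> * \<beta>"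
      proof cases
        case 1
        then have "\<rho> * \<delta> + \<rho> \<le> \<rho> * \<alpha>" by (rule mult_add_one_le)
        then show ?thesis by (rule order_trans) simp
      next
        case 2
        then have "\<rho> * \<delta> + \<rho> = \<rho> * \<alpha> + (\<rho> * \<gamma> + \<rho>)" using less by (simp add: add_ord_assoc)
        then show ?thesis using mult_add_one_le[OF 2(1), of \<rho>]
          by (metis add_ord_less_cancel not_le)
      qed
    qed
    \<comment> \<open>With \<open>\<rho> * \<alpha>\<close> split off on the left, the remaining
      inequality becomes \<open>\<rho> * \<beta> \<le> \<delta>\<close> by left
      cancellation.\<close>
    obtain \<delta> where \<delta>: "\<rho> * (\<alpha> + \<beta>) = \<rho> * \<alpha> + \<delta>"
    proof (cases "\<beta> = 0")
      case False
      then have "\<alpha> < \<alpha> + \<beta>" by (metis add_ord_cancel add_ord_zero_right le_add_ord le_less)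
      then have "\<rho> * \<alpha> \<le> \<rho> * (\<alpha> + \<beta>)" by (meson le_add_ord mult_add_one_le order_trans)
      then show ?thesis using ord_diff_ex that by blast
    qed (use that[of 0] in simp)
    have "\<rho> * \<gamma> + \<rho> \<le> \<delta>" if "\<gamma> < \<beta>" for \<gamma>
      using that mult_add_one_le[of "\<alpha> + \<gamma>" "\<alpha> + \<beta>" \<rho>] less
      by (simp add: add_ord_assoc \<delta>) (metis add_ord_less_cancel not_le)
    then have "\<rho> * \<beta> \<le> \<delta>" by (simp add: mult_ord_le_iff[of \<rho> \<beta>])
    then show "\<rho> * \<alpha> + \<rho> * \<beta> \<le> \<rho> * (\<alpha> + \<beta>)" unfolding \<delta>
      by (metis add_ord_less_cancel not_le)
  qed
qed

lemma ord_division: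
  fixes \<rho> :: "'a::infinite ord"
  assumes "0 < \<rho>"
  obtains \<zeta> \<epsilon> where "\<beta> = \<rho> * \<zeta> + \<epsilon>" "\<epsilon> < \<rho>"
proof -
  \<comment> \<open>This puts \<open>\<beta>\<close> below the end of the block with index
    \<open>\<beta>\<close>, so that a least such index exists.\<close>
  have *: "\<beta> \<le> \<rho> * \<beta>" for \<beta>
  proof (induction \<beta> rule: less_induct)
    case (less \<beta>)
    show ?case
    proof (rule ccontr)
      assume "\<not> \<beta> \<le> \<rho> * \<beta>"
      then have a: "\<rho> * \<beta> < \<beta>" by simp
      then have "\<rho> * \<beta> \<le> \<rho> * (\<rho> * \<beta>)" using less by blast
      moreover have "\<rho> * (\<rho> * \<beta>) < \<rho> * (\<rho> * \<beta>) + \<rho>"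
        using assms add_ord_strict_mono[of 0 \<rho> "\<rho> * (\<rho> * \<beta>)"] by simp
      ultimately show False using mult_add_one_le[OF a, of \<rho>] by simp
    qed
  qed
  \<comment> \<open>The index of the first block ending after \<open>\<beta>\<close>. All earlier
    blocks end at or before \<open>\<beta>\<close>, hence
    \<open>\<rho> * \<zeta> \<le> \<beta>\<close>.\<close>
  define \<zeta> where "\<zeta> = (LEAST \<zeta>. \<beta> < \<rho> * \<zeta> + \<rho>)"
  have "\<beta> < \<rho> * \<beta> + \<rho>"
    using *[of \<beta>] assms add_ord_strict_mono[of 0 \<rho> "\<rho> * \<beta>"] by simp
  then have 1: "\<beta> < \<rho> * \<zeta> + \<rho>" unfolding \<zeta>_def by (rule LeastI)
  have "\<rho> * \<zeta> \<le> \<beta>"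
    using not_less_Least[of _ "\<lambda>\<zeta>. \<beta> < \<rho> * \<zeta> + \<rho>", folded \<zeta>_def]
    by (auto simp: mult_ord_le_iff[of \<rho> \<zeta>] not_less)
  then obtain \<epsilon> where "\<beta> = \<rho> * \<zeta> + \<epsilon>" using ord_diff_ex by blast
  with 1 that show ?thesis by auto
qed

lemma dvd_add_mult_iff:
  fixes \<rho> :: "'a::infinite ord"
  assumes "\<epsilon> < \<rho>"
  shows "\<rho> dvd \<rho> * \<zeta> + \<epsilon> \<longleftrightarrow> \<epsilon> = 0"
proof
  assume "\<rho> dvd \<rho> * \<zeta> + \<epsilon>"
  then obtain \<eta> where "\<rho> * \<zeta> + \<epsilon> = \<rho> * \<eta> + 0" by (auto simp: dvd_def)
  then show "\<epsilon> = 0" by (rule ord_division_unique) (use assms in \<open>auto intro: le_less_trans[OF zero_le_ord]\<close>)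
qed (auto simp: dvd_def)

text \<open>Indecomposability keeps all \<open>\<epsilon> + \<delta>\<close> with
  \<open>\<delta> < \<rho>\<close> below \<open>\<rho>\<close>. Later this makes
  \<open>1 + d\<close> and \<open>\<alpha> + d\<close> reach a block boundary at the same
  \<open>d\<close>, namely \<open>d = \<rho>\<close>.\<close>

lemma add_ord_right_absorb:
  fixes \<rho> :: "'a::infinite ord"
  assumes "indecomposable \<rho>" "\<epsilon> < \<rho>"
  shows "\<epsilon> + \<rho> = \<rho>"
  using assms by (intro antisym le_add_ord_left) (auto simp: add_ord_le_iff[of \<epsilon> \<rho>] indecomposable_def)

text \<open>Adding a multiple of \<open>\<rho>\<close> on the left changes the quotient by
  \<open>\<rho>\<close> but not the remainder. Hence translations between multiples of
  \<open>\<rho>\<close> respect all the functions \<open>f_op \<rho> \<xi>\<close>.\<close>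

lemma f_op_add:
  fixes \<rho> :: "'a::infinite ord"
  assumes "0 < \<rho>" "\<rho> dvd p"
  shows "f_op \<rho> \<xi> (p + c) = p + f_op \<rho> \<xi> c"
proof -
  obtain \<zeta> where p: "p = \<rho> * \<zeta>" using assms by (auto simp: dvd_def)
  obtain \<eta> \<epsilon> where c: "c = \<rho> * \<eta> + \<epsilon>" "\<epsilon> < \<rho>" using ord_division[OF assms(1)] by blast
  have pc: "p + c = \<rho> * (\<zeta> + \<eta>) + \<epsilon>" by (simp add: p c mult_add_ord add_ord_assoc)
  show ?thesis
  proof (cases "\<epsilon> = 0")
    case True
    then show ?thesis unfolding pc using c
      by (simp add: f_op_mult) (simp add: p mult_add_ord add_ord_assoc)
  next
    case False
    then have "0 < \<epsilon>" by (simp add: ord_zero_less_iff)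
    then show ?thesis unfolding pc using c
      by (simp add: f_op_mult_add) (simp add: p mult_add_ord)
  qed
qed

lemma dvd_add_ord_iff:
  fixes \<rho> :: "'a::infinite ord"
  assumes "0 < \<rho>" "\<rho> dvd p"
  shows "\<rho> dvd p + c \<longleftrightarrow> \<rho> dvd c"
proof -
  obtain \<zeta> where p: "p = \<rho> * \<zeta>" using assms by (auto simp: dvd_def)
  obtain \<eta> \<epsilon> where c: "c = \<rho> * \<eta> + \<epsilon>" "\<epsilon> < \<rho>" using ord_division[OF assms(1)] by blast
  have pc: "p + c = \<rho> * (\<zeta> + \<eta>) + \<epsilon>" by (simp add: p c mult_add_ord add_ord_assoc)
  show ?thesis unfolding pc using c by (simp add: dvd_add_mult_iff)
qed

text \<open>Turns divisibility into an equation of the kind that coverings preserve.\<close>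

lemma f_op_zero_iff:
  fixes \<rho> :: "'a::infinite ord"
  assumes "0 < \<rho>"
  shows "f_op \<rho> 0 x = x \<longleftrightarrow> \<rho> dvd x"
proof -
  obtain \<zeta> \<epsilon> where x: "x = \<rho> * \<zeta> + \<epsilon>" "\<epsilon> < \<rho>" using ord_division[OF assms(1)] by blast
  show ?thesis
  proof (cases "\<epsilon> = 0")
    case False
    then have "0 < \<epsilon>" by (simp add: ord_zero_less_iff)
    then have "f_op \<rho> 0 x = \<rho> * \<zeta> + 0" using x by (simp add: f_op_mult_add)
    then show ?thesis using x False by (simp add: dvd_add_mult_iff del: add_ord_zero_right)
  qed (auto simp: x f_op_mult dvd_def)
qed

text \<open>The value exceeds the base of the block of \<open>u\<close> by at most
  \<open>\<xi>\<close>, and that whole block lies below the multiple \<open>q\<close>.\<close>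

lemma f_op_less:
  fixes \<rho> :: "'a::infinite ord"
  assumes "0 < \<rho>" "\<rho> dvd q" "\<xi> < \<rho>" "u < q"
  shows "f_op \<rho> \<xi> u < q"
proof -
  obtain \<kappa> where q: "q = \<rho> * \<kappa>" using assms by (auto simp: dvd_def)
  obtain \<zeta> \<epsilon> where u: "u = \<rho> * \<zeta> + \<epsilon>" "\<epsilon> < \<rho>" using ord_division[OF assms(1)] by blast
  have "\<not> \<kappa> \<le> \<zeta>"
  proof
    assume "\<kappa> \<le> \<zeta>"
    then have "\<rho> * \<kappa> \<le> \<rho> * \<zeta>"
      by (metis le_add_ord le_less mult_add_one_le order_trans)
    then show False using assms(4) unfolding u q using le_add_ord by (metis leD order_trans)
  qed
  then have *: "\<rho> * \<zeta> + \<rho> \<le> q" by (simp add: q mult_add_one_le)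
  have "f_op \<rho> \<xi> u \<le> \<rho> * \<zeta> + \<xi>"
  proof (cases "\<epsilon> = 0")
    case False
    then have "0 < \<epsilon>" by (simp add: ord_zero_less_iff)
    then show ?thesis using u by (simp add: f_op_mult_add)
  qed (simp add: u f_op_mult)
  also have "\<dots> < \<rho> * \<zeta> + \<rho>" using assms by simp
  finally show ?thesis using * by simp
qed

lemma f_op_ge:
  fixes \<rho> :: "'a::infinite ord"
  assumes "0 < \<rho>" "\<rho> dvd q" "q \<le> u"
  shows "q \<le> f_op \<rho> \<xi> u"
  using assms ord_diff_ex[of q u] by (auto simp: f_op_add)

section \<open>Coverings\<close>

text \<open>For \<open>u \<ge> p\<close> the ordinal \<open>c\<close> is unique by left
  cancellation. Below \<open>p\<close> the value is unspecified, so the map is only applied from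
  \<open>p\<close> on.\<close>

definition shift :: "'a ord \<Rightarrow> 'a ord \<Rightarrow> 'a ord \<Rightarrow> 'a ord" where
  "shift p q u = q + (THE c. u = p + c)"

lemma shift_add [simp]: "shift p q (p + c) = q + (c :: 'a::infinite ord)"
  by (simp add: shift_def)

text \<open>Cutting at a multiple of \<open>\<rho>\<close> loses no bases: the base of the block of
  \<open>p + c\<close> has the form \<open>p + d\<close>, and then \<open>q + d\<close> is the base
  of the block of \<open>q + c\<close>.\<close>

lemma closed_set_shift:
  fixes \<rho> :: "'a::infinite ord"
  assumes "0 < \<rho>" "\<rho> dvd p" "\<rho> dvd q" "closed_set \<rho> S"
  shows "closed_set \<rho> (shift q p ` (S \<inter> {q..}))"
  unfolding closed_set_def
proof (intro allI impI, elim conjE exE)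
  fix \<sigma> \<xi> assume *: "\<rho> dvd \<sigma>" "\<xi> < \<rho>" "\<sigma> + \<xi> \<in> shift q p ` (S \<inter> {q..})"
  then obtain c where c: "q + c \<in> S" "\<sigma> + \<xi> = p + c"
    using ord_diff_ex[of q] by force
  have "p \<le> \<sigma>"
  proof (rule ccontr)
    assume "\<not> p \<le> \<sigma>"
    then have "f_op \<rho> \<xi> \<sigma> < p" using * assms by (intro f_op_less) auto
    also have "f_op \<rho> \<xi> \<sigma> = p + c" using *(1) c by (auto simp: dvd_def f_op_mult)
    finally show False using le_add_ord[of p c] by (metis leD)
  qed
  then obtain d where d: "\<sigma> = p + d" using ord_diff_ex by blast
  then have "c = d + \<xi>" using c by (simp add: add_ord_assoc)
  then have "(q + d) + \<xi> \<in> S" using c by (simp add: add_ord_assoc)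
  moreover have "\<rho> dvd q + d" using * assms d by (simp add: dvd_add_ord_iff)
  ultimately have "q + d \<in> S" using assms *(2) unfolding closed_set_def by blast
  then show "\<sigma> \<in> shift q p ` (S \<inter> {q..})" unfolding d
    by (intro image_eqI[of _ _ "q + d"]) auto
qed

text \<open>A covering sends block bases to block bases. It also keeps the remainder, because
  \<open>f_op \<rho> \<epsilon>\<close> takes the base to the element with remainder
  \<open>\<epsilon>\<close>. So the base required for \<open>g s\<close> is the image of the base of
  \<open>s\<close>.\<close>

lemma closed_set_covering:
  fixes \<rho> :: "'a::infinite ord"
  assumes "0 < \<rho>" "closed_set \<rho> S" "covering \<rho> L S g"
  shows "closed_set \<rho> (g ` S)"
  unfolding closed_set_def
proof (intro allI impI, elim conjE exE)
  fix \<sigma> \<xi> assume *: "\<rho> dvd \<sigma>" "\<xi> < \<rho>" "\<sigma> + \<xi> \<in> g ` S"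
  then obtain s where s: "s \<in> S" "\<sigma> + \<xi> = g s" by auto
  obtain \<zeta> \<epsilon> where \<zeta>: "s = \<rho> * \<zeta> + \<epsilon>" "\<epsilon> < \<rho>" using ord_division[OF assms(1)] by blast
  have base: "\<rho> * \<zeta> \<in> S"
    using assms(2) s(1) \<zeta> unfolding closed_set_def dvd_def by blast
  have cov: "f_op \<rho> \<xi> x = y \<longleftrightarrow> f_op \<rho> \<xi> (g x) = g y" if "x \<in> S" "y \<in> S" "\<xi> < \<rho>" for x y \<xi>
    using assms(3) that unfolding covering_def by blast
  have "f_op \<rho> \<epsilon> (\<rho> * \<zeta>) = s" by (simp add: f_op_mult \<zeta>)
  then have 1: "f_op \<rho> \<epsilon> (g (\<rho> * \<zeta>)) = g s" using cov base s \<zeta> by blast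
  have "\<rho> dvd g (\<rho> * \<zeta>)"
    using cov[OF base base assms(1)] assms(1) by (simp add: f_op_mult f_op_zero_iff)
  then obtain \<eta> where \<eta>: "g (\<rho> * \<zeta>) = \<rho> * \<eta>" by (auto simp: dvd_def)
  obtain \<eta>' where \<eta>': "\<sigma> = \<rho> * \<eta>'" using * by (auto simp: dvd_def)
  have "\<rho> * \<eta> + \<epsilon> = \<rho> * \<eta>' + \<xi>" using 1 s \<eta> \<eta>' by (simp add: f_op_mult)
  then have "\<eta> = \<eta>'" by (rule ord_division_unique) (use * \<zeta> in auto)
  then show "\<sigma> \<in> g ` S" using base \<eta> \<eta>' by force
qed

section \<open>Elementary properties of coverings\<close>

lemma le_imp_less_eq: "le \<rho> k \<alpha> \<beta> \<Longrightarrow> \<alpha> \<le> \<beta>"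
  by (auto simp: le_unfold[of \<rho> k \<alpha> \<beta>] le1_cond_def le2_cond_def)

lemma covering_le:
  "covering \<rho> L S g \<Longrightarrow> x \<in> S \<Longrightarrow> y \<in> S \<Longrightarrow> k \<in> {1, 2} \<Longrightarrow> L k x y \<Longrightarrow> L k (g x) (g y)"
  unfolding covering_def by blast

lemma covering_f_op_iff:
  "covering \<rho> L S g \<Longrightarrow> x \<in> S \<Longrightarrow> y \<in> S \<Longrightarrow> \<xi> < \<rho> \<Longrightarrow>
    f_op \<rho> \<xi> x = y \<longleftrightarrow> f_op \<rho> \<xi> (g x) = g y"
  unfolding covering_def by blast

lemma covering_less:
  "covering \<rho> L S g \<Longrightarrow> x \<in> S \<Longrightarrow> y \<in> S \<Longrightarrow> x < y \<Longrightarrow> g x < g y"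
  unfolding covering_def by (blast dest: strict_mono_onD)

lemma covering_less_eq:
  "covering \<rho> L S g \<Longrightarrow> x \<in> S \<Longrightarrow> y \<in> S \<Longrightarrow> x \<le> y \<Longrightarrow> g x \<le> g y"
  using covering_less by (fastforce simp: le_less)

lemma covering_subset: "covering \<rho> L S g \<Longrightarrow> T \<subseteq> S \<Longrightarrow> covering \<rho> L T g"
  unfolding covering_def strict_mono_on_def by (meson subsetD)

lemma covering_id: "covering \<rho> L S (\<lambda>x. x)"
  unfolding covering_def strict_mono_on_def by blast

lemma covering_comp:
  "covering \<rho> L S g \<Longrightarrow> covering \<rho> L (g ` S) h \<Longrightarrow> covering \<rho> L S (h \<circ> g)"
  unfolding covering_def strict_mono_on_def by simp

text \<open>\<open>X\<close> is an initial segment of both domain and range, and an increasing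
  surjection between well-orders fixes a common initial segment pointwise.\<close>

lemma strict_mono_on_fixes_initial:
  fixes g :: "'a ord \<Rightarrow> 'a ord"
  assumes g: "strict_mono_on (X \<union> Y) g" "g ` (X \<union> Y) = X \<union> Z"
    and "set_less X Y" "set_less X Z"
  shows "x \<in> X \<Longrightarrow> g x = x" "g ` Y = Z"
proof -
  show fixed: "g x = x" if "x \<in> X" for x
    using that
  proof (induction x rule: less_induct)
    case (less x)
    have "x \<in> g ` (X \<union> Y)" unfolding g(2) using less.prems by blast
    then obtain z where z: "z \<in> X \<union> Y" "g z = x" by blast
    \<comment> \<open>A preimage \<open>z < x\<close> would lie in \<open>X\<close> and, by
      induction, be its own image.\<close>
    have "x \<le> z"
    proof (rule ccontr)
      assume "\<not> x \<le> z"
      then have "z < x" by simp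
      then have "z \<in> X" using z(1) assms(3) less.prems unfolding set_less_def by (metis UnE less_asym)
      then show False using less.IH[OF \<open>z < x\<close>] z \<open>z < x\<close> by simp
    qed
    then have le: "g x \<le> x" using z g(1) less.prems
      by (metis UnI1 strict_mono_on_leD)
    show ?case
    proof (rule ccontr)
      assume "g x \<noteq> x"
      \<comment> \<open>Then \<open>g x\<close> would be an earlier element of \<open>X\<close>,
        fixed by induction, while monotonicity gives \<open>g (g x) < g x\<close>.\<close>
      with le have lt: "g x < x" by simp
      have "g x \<in> X \<union> Z" unfolding g(2)[symmetric] using less.prems by blast
      then have "g x \<in> X" using lt assms(4) less.prems by (auto simp: set_less_def dest: less_asym)
      then have "g (g x) = g x" using less.IH lt by blast
      moreover have "g (g x) < g x" using strict_mono_onD[OF g(1) _ _ lt] \<open>g x \<in> X\<close> less.prems by blast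
      ultimately show False by simp
    qed
  qed
  have inj: "inj_on g (X \<union> Y)" using g(1) by (rule strict_mono_on_imp_inj_on)
  have disj: "X \<inter> Y = {}" "X \<inter> Z = {}" using assms(3,4) by (auto simp: set_less_def)
  have "g ` X = X" using fixed by force
  moreover have "X \<union> Y - X = Y" using disj(1) by blast
  ultimately have "g ` Y = X \<union> Z - X"
    using inj_on_image_set_diff[OF inj, of "X \<union> Y" X] g(2) by simp
  then show "g ` Y = Z" using disj(2) by blast
qed

text \<open>Passes from the range of a covering to the map itself, which must be the identity on
  \<open>X\<close>.\<close>

lemma is_covering_of_Un_iff:
  assumes "set_less X Y"
  shows "set_less X Z \<and> is_covering_of \<rho> L (X \<union> Z) (X \<union> Y) \<longleftrightarrow>
    (\<exists>g. covering \<rho> L (X \<union> Y) g \<and> (\<forall>x\<in>X. g x = x) \<and> g ` Y = Z)" (is "?l \<longleftrightarrow> ?r")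
proof
  assume l: ?l
  then obtain g where g: "covering \<rho> L (X \<union> Y) g" "X \<union> Z = g ` (X \<union> Y)"
    by (auto simp: is_covering_of_def)
  then show ?r
    using strict_mono_on_fixes_initial[of X Y g Z] assms l unfolding covering_def by blast
next
  assume ?r
  then obtain g where g: "covering \<rho> L (X \<union> Y) g" "\<forall>x\<in>X. g x = x" "g ` Y = Z" by blast
  have "set_less X Z" unfolding set_less_def
  proof (intro ballI)
    fix x z assume x: "x \<in> X" "z \<in> Z"
    then obtain y where "y \<in> Y" "z = g y" using g by blast
    then show "x < z" using covering_less[OF g(1), of x y] g(2) x assms by (simp add: set_less_def)
  qed
  moreover have "X \<union> Z = g ` (X \<union> Y)" using g(2,3) by (force simp: image_Un)
  ultimately show ?l using g(1) unfolding is_covering_of_def by blast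
qed

text \<open>An increasing map keeps positions in the enumeration. This translates the condition on
  i-th elements in the downward clause into one on \<open>y\<close> and \<open>g y\<close>.\<close>

lemma sorted_list_of_set_image:
  fixes g :: "'a::linorder \<Rightarrow> 'b::linorder"
  assumes "finite Y" "strict_mono_on Y g"
  shows "sorted_list_of_set (g ` Y) = map g (sorted_list_of_set Y)"
proof (rule sorted_list_of_set.idem_if_sorted_distinct[THEN subst])
  show "sorted (map g (sorted_list_of_set Y))"
    using assms strict_mono_on_leD[OF assms(2)]
    by (auto simp: sorted_map intro!: sorted_wrt_mono_rel[OF _ sorted_sorted_list_of_set])
  show "distinct (map g (sorted_list_of_set Y))"
    using assms by (simp add: distinct_map strict_mono_on_imp_inj_on)
qed (use assms in simp)

text \<open>
  A covering of \<open>X \<union> Y\<close> by \<open>X \<union> Y'\<close> with \<open>X < Y\<close> and \<open>X < Y'\<close> is the identity on \<open>X\<close>, so both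
  \<open>\<le>\<^sub>1\<close> and the downward clause of \<open>\<le>\<^sub>2\<close> can be expressed with the covering map instead of its
  range; \<open>Q\<close> and \<open>R\<close> carry the condition of the latter on \<open>\<le>\<^sub>1\<close>.
\<close>

definition reflects ::
    "'a ord \<Rightarrow> 'a ord \<Rightarrow> 'a ord \<Rightarrow> ('a ord \<Rightarrow> bool) \<Rightarrow> ('a ord \<Rightarrow> bool) \<Rightarrow> bool" where
  "reflects \<rho> \<alpha> \<beta> Q R \<longleftrightarrow>
    (\<forall>X Y. finite X \<and> X \<subseteq> {..<\<alpha>} \<and> finite Y \<and> Y \<subseteq> {\<alpha>..<\<beta>} \<and> closed_set \<rho> (X \<union> Y) \<longrightarrow>
      (\<exists>g. covering \<rho> (le \<rho>) (X \<union> Y) g \<and> (\<forall>x\<in>X. g x = x) \<and> g ` Y \<subseteq> {..<\<alpha>} \<and>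
        (\<forall>y\<in>Y. Q y \<longrightarrow> R (g y))))"

lemma reflectsE:
  assumes "reflects \<rho> \<alpha> \<beta> Q R"
    "finite X" "X \<subseteq> {..<\<alpha>}" "finite Y" "Y \<subseteq> {\<alpha>..<\<beta>}" "closed_set \<rho> (X \<union> Y)"
  obtains g where "covering \<rho> (le \<rho>) (X \<union> Y) g" "\<And>x. x \<in> X \<Longrightarrow> g x = x" "g ` Y \<subseteq> {..<\<alpha>}"
    "\<And>y. y \<in> Y \<Longrightarrow> Q y \<Longrightarrow> R (g y)"
  using assms unfolding reflects_def by meson

lemma le_1_iff_reflects:
  "le \<rho> 1 \<alpha> \<beta> \<longleftrightarrow> \<alpha> \<le> \<beta> \<and> reflects \<rho> \<alpha> \<beta> (\<lambda>_. True) (\<lambda>_. True)"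
proof -
  have "(\<exists>Y'. finite Y' \<and> Y' \<subseteq> {..<\<alpha>} \<and> set_less X Y' \<and>
        is_covering_of \<rho> (le \<rho>) (X \<union> Y') (X \<union> Y)) \<longleftrightarrow>
      (\<exists>g. covering \<rho> (le \<rho>) (X \<union> Y) g \<and> (\<forall>x\<in>X. g x = x) \<and> g ` Y \<subseteq> {..<\<alpha>})"
    if *: "X \<subseteq> {..<\<alpha>}" "finite Y" "Y \<subseteq> {\<alpha>..<\<beta>}" for X Y
  proof -
    have "set_less X Y" using * by (fastforce simp: set_less_def)
    have "(\<exists>Y'. finite Y' \<and> Y' \<subseteq> {..<\<alpha>} \<and> set_less X Y' \<and>
        is_covering_of \<rho> (le \<rho>) (X \<union> Y') (X \<union> Y)) \<longleftrightarrow>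
      (\<exists>Y'. finite Y' \<and> Y' \<subseteq> {..<\<alpha>} \<and>
        (\<exists>g. covering \<rho> (le \<rho>) (X \<union> Y) g \<and> (\<forall>x\<in>X. g x = x) \<and> g ` Y = Y'))"
      by (simp only: is_covering_of_Un_iff[OF \<open>set_less X Y\<close>])
    then show ?thesis using *(2) by blast
  qed
  then show ?thesis unfolding le_1_iff le1_cond_def reflects_def by auto
qed

lemma le2_down_iff_reflects:
  "le2_down \<rho> (le \<rho>) \<alpha> \<beta> \<longleftrightarrow> reflects \<rho> \<alpha> \<beta> (\<lambda>y. le \<rho> 1 y \<beta>) (\<lambda>y. le \<rho> 1 y \<alpha>)"
proof -
  have "(\<exists>Y'. finite Y' \<and> Y' \<subseteq> {..<\<alpha>} \<and> set_less X Y' \<and>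
        is_covering_of \<rho> (le \<rho>) (X \<union> Y') (X \<union> Y) \<and>
        (\<forall>i<card Y. le \<rho> 1 (sorted_list_of_set Y ! i) \<beta> \<longrightarrow>
          le \<rho> 1 (sorted_list_of_set Y' ! i) \<alpha>)) \<longleftrightarrow>
      (\<exists>g. covering \<rho> (le \<rho>) (X \<union> Y) g \<and> (\<forall>x\<in>X. g x = x) \<and> g ` Y \<subseteq> {..<\<alpha>} \<and>
        (\<forall>y\<in>Y. le \<rho> 1 y \<beta> \<longrightarrow> le \<rho> 1 (g y) \<alpha>))" (is "?l \<longleftrightarrow> ?r")
    if *: "X \<subseteq> {..<\<alpha>}" "finite Y" "Y \<subseteq> {\<alpha>..<\<beta>}" for X Y
  proof -
    have less: "set_less X Y" using * by (fastforce simp: set_less_def)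
    have sorted: "(\<forall>i<card Y. le \<rho> 1 (sorted_list_of_set Y ! i) \<beta> \<longrightarrow>
          le \<rho> 1 (sorted_list_of_set (g ` Y) ! i) \<alpha>) \<longleftrightarrow>
        (\<forall>y\<in>Y. le \<rho> 1 y \<beta> \<longrightarrow> le \<rho> 1 (g y) \<alpha>)"
      if "covering \<rho> (le \<rho>) (X \<union> Y) g" for g
    proof -
      have "strict_mono_on Y g" using that unfolding covering_def strict_mono_on_def by blast
      then show ?thesis
        using all_set_conv_all_nth[of "sorted_list_of_set Y" "\<lambda>y. le \<rho> 1 y \<beta> \<longrightarrow> le \<rho> 1 (g y) \<alpha>"] *(2)
        by (simp add: sorted_list_of_set_image)
    qed
    show ?thesis
    proof
      assume ?l
      then obtain Y' where Y': "Y' \<subseteq> {..<\<alpha>}"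
        "set_less X Y' \<and> is_covering_of \<rho> (le \<rho>) (X \<union> Y') (X \<union> Y)"
        "\<forall>i<card Y. le \<rho> 1 (sorted_list_of_set Y ! i) \<beta> \<longrightarrow>
          le \<rho> 1 (sorted_list_of_set Y' ! i) \<alpha>" by blast
      from Y'(2) obtain g where g: "covering \<rho> (le \<rho>) (X \<union> Y) g" "\<forall>x\<in>X. g x = x" "g ` Y = Y'"
        unfolding is_covering_of_Un_iff[OF less] by blast
      have "\<forall>y\<in>Y. le \<rho> 1 y \<beta> \<longrightarrow> le \<rho> 1 (g y) \<alpha>"
        using sorted[OF g(1), unfolded g(3)] Y'(3) by (rule iffD1)
      then show ?r using g Y'(1) by (intro exI[of _ g]) simp
    next
      assume ?r
      then obtain g where g: "covering \<rho> (le \<rho>) (X \<union> Y) g" "\<forall>x\<in>X. g x = x" "g ` Y \<subseteq> {..<\<alpha>}"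
        "\<forall>y\<in>Y. le \<rho> 1 y \<beta> \<longrightarrow> le \<rho> 1 (g y) \<alpha>" by (elim exE conjE)
      have "\<exists>h. covering \<rho> (le \<rho>) (X \<union> Y) h \<and> (\<forall>x\<in>X. h x = x) \<and> h ` Y = g ` Y"
        using g(1,2) by (intro exI[of _ g]) simp
      then have "set_less X (g ` Y) \<and> is_covering_of \<rho> (le \<rho>) (X \<union> g ` Y) (X \<union> Y)"
        unfolding is_covering_of_Un_iff[OF less] .
      moreover have "finite (g ` Y)" using * by simp
      ultimately show ?l using g(3) sorted[OF g(1), THEN iffD2, OF g(4)] by (intro exI[of _ "g ` Y"]) simp
    qed
  qed
  note iff = this
  show ?thesis unfolding le2_down_def reflects_def
    by (intro all_cong1 imp_cong refl iff; elim conjE; assumption)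
qed

text \<open>The premise and the conclusion of the upward clause, with ranges replaced by maps as in
  \<open>reflects\<close>.\<close>

definition extends_cofinally :: "'a ord \<Rightarrow> 'a ord \<Rightarrow> 'a ord set \<Rightarrow> 'a ord set \<Rightarrow> bool" where
  "extends_cofinally \<rho> \<alpha> X Y \<longleftrightarrow>
    (\<forall>\<gamma><\<alpha>. \<exists>g. covering \<rho> (le \<rho>) (X \<union> Y) g \<and> (\<forall>x\<in>X. g x = x) \<and> g ` Y \<subseteq> {\<gamma><..<\<alpha>})"

lemma extends_cofinallyE:
  assumes "extends_cofinally \<rho> \<alpha> X Y" "\<gamma> < \<alpha>"
  obtains g where "covering \<rho> (le \<rho>) (X \<union> Y) g" "\<And>x. x \<in> X \<Longrightarrow> g x = x" "g ` Y \<subseteq> {\<gamma><..<\<alpha>}"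
  using assms unfolding extends_cofinally_def by meson

lemma cofinally_many_iff_extends_cofinally:
  assumes "finite X" "X \<subseteq> {..<\<alpha>}" "finite Y" "set_less X Y"
  shows "cofinally_many \<alpha> (\<lambda>Y'. is_covering_of \<rho> (le \<rho>) (X \<union> Y') (X \<union> Y)) \<longleftrightarrow>
    extends_cofinally \<rho> \<alpha> X Y"
proof
  assume l: "cofinally_many \<alpha> (\<lambda>Y'. is_covering_of \<rho> (le \<rho>) (X \<union> Y') (X \<union> Y))"
  show "extends_cofinally \<rho> \<alpha> X Y" unfolding extends_cofinally_def
  proof (intro allI impI)
    fix \<gamma> assume "\<gamma> < \<alpha>"
    \<comment> \<open>The bound is raised above \<open>X\<close>, because
      \<open>cofinally_many\<close> does not itself demand that the new set lie above
      \<open>X\<close>.\<close>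
    define \<delta> where "\<delta> = Max (insert \<gamma> X)"
    have \<delta>: "\<gamma> \<le> \<delta>" "\<And>x. x \<in> X \<Longrightarrow> x \<le> \<delta>" "\<delta> < \<alpha>"
      using assms \<open>\<gamma> < \<alpha>\<close> unfolding \<delta>_def by (auto simp del: Max_insert)
    then obtain Y' where Y': "Y' \<subseteq> {\<delta><..<\<alpha>}" "is_covering_of \<rho> (le \<rho>) (X \<union> Y') (X \<union> Y)"
      using l unfolding cofinally_many_def by blast
    moreover have "set_less X Y'" using Y'(1) \<delta>(2) by (force simp: set_less_def)
    ultimately obtain g where "covering \<rho> (le \<rho>) (X \<union> Y) g" "\<forall>x\<in>X. g x = x" "g ` Y = Y'"
      using is_covering_of_Un_iff[OF assms(4)] by metis
    moreover have "Y' \<subseteq> {\<gamma><..<\<alpha>}" using Y'(1) \<delta>(1) by fastforce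
    ultimately show "\<exists>g. covering \<rho> (le \<rho>) (X \<union> Y) g \<and> (\<forall>x\<in>X. g x = x) \<and> g ` Y \<subseteq> {\<gamma><..<\<alpha>}"
      by blast
  qed
next
  assume r: "extends_cofinally \<rho> \<alpha> X Y"
  show "cofinally_many \<alpha> (\<lambda>Y'. is_covering_of \<rho> (le \<rho>) (X \<union> Y') (X \<union> Y))"
    unfolding cofinally_many_def
  proof (intro allI impI)
    fix \<gamma> assume "\<gamma> < \<alpha>"
    with r obtain g where g: "covering \<rho> (le \<rho>) (X \<union> Y) g" "\<forall>x\<in>X. g x = x" "g ` Y \<subseteq> {\<gamma><..<\<alpha>}"
      unfolding extends_cofinally_def by blast
    have "\<exists>h. covering \<rho> (le \<rho>) (X \<union> Y) h \<and> (\<forall>x\<in>X. h x = x) \<and> h ` Y = g ` Y"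
      using g(1,2) by (intro exI[of _ g]) simp
    then have "is_covering_of \<rho> (le \<rho>) (X \<union> g ` Y) (X \<union> Y)"
      by (rule is_covering_of_Un_iff[OF assms(4), THEN iffD2, THEN conjunct2])
    then show "\<exists>Y'. finite Y' \<and> Y' \<subseteq> {\<gamma><..<\<alpha>} \<and> is_covering_of \<rho> (le \<rho>) (X \<union> Y') (X \<union> Y)"
      using g(3) assms(3) by (intro exI[of _ "g ` Y"]) simp
  qed
qed

lemma le_2_iff_reflects:
  "le \<rho> 2 \<alpha> \<beta> \<longleftrightarrow> \<alpha> \<le> \<beta> \<and>
    (\<forall>X Y. finite X \<and> X \<subseteq> {..<\<alpha>} \<and> finite Y \<and> Y \<subseteq> {..<\<alpha>} \<and> closed_set \<rho> (X \<union> Y) \<and>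
        set_less X Y \<longrightarrow> extends_cofinally \<rho> \<alpha> X Y \<longrightarrow> extends_cofinally \<rho> \<beta> X Y) \<and>
    reflects \<rho> \<alpha> \<beta> (\<lambda>y. le \<rho> 1 y \<beta>) (\<lambda>y. le \<rho> 1 y \<alpha>)"
proof (cases "\<alpha> \<le> \<beta>")
  case True
  have sub: "X \<subseteq> {..<\<beta>}" if "X \<subseteq> {..<\<alpha>}" for X using that True by fastforce
  have "le2_up \<rho> (le \<rho>) \<alpha> \<beta> \<longleftrightarrow>
    (\<forall>X Y. finite X \<and> X \<subseteq> {..<\<alpha>} \<and> finite Y \<and> Y \<subseteq> {..<\<alpha>} \<and> closed_set \<rho> (X \<union> Y) \<and>
        set_less X Y \<longrightarrow> extends_cofinally \<rho> \<alpha> X Y \<longrightarrow> extends_cofinally \<rho> \<beta> X Y)"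
    unfolding le2_up_def
    by (intro all_cong1 imp_cong refl cofinally_many_iff_extends_cofinally) (use sub in blast)+
  then show ?thesis by (simp add: le_2_iff le2_cond_def le2_down_iff_reflects)
qed (simp add: le_2_iff le2_cond_def)

section \<open>Comparison of the two relations, smaller right arguments, reflexivity\<close>

lemma reflects_mono:
  assumes "reflects \<rho> \<alpha> \<beta> Q R" "\<delta> \<le> \<beta>"
  shows "reflects \<rho> \<alpha> \<delta> (\<lambda>_. True) (\<lambda>_. True)"
  unfolding reflects_def
proof (intro allI impI, elim conjE)
  fix X Y assume *: "finite X" "X \<subseteq> {..<\<alpha>}" "finite Y" "Y \<subseteq> {\<alpha>..<\<delta>}" "closed_set \<rho> (X \<union> Y)"
  then have "Y \<subseteq> {\<alpha>..<\<beta>}" using assms(2) by fastforce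
  from reflectsE[OF assms(1) *(1-3) this *(5)]
  obtain g where "covering \<rho> (le \<rho>) (X \<union> Y) g" "\<And>x. x \<in> X \<Longrightarrow> g x = x" "g ` Y \<subseteq> {..<\<alpha>}"
    by metis
  then show "\<exists>g. covering \<rho> (le \<rho>) (X \<union> Y) g \<and> (\<forall>x\<in>X. g x = x) \<and> g ` Y \<subseteq> {..<\<alpha>} \<and>
      (\<forall>y\<in>Y. True \<longrightarrow> True)" by blast
qed

text \<open>The downward clause is reflection with a side condition, which can be forgotten.\<close>

lemma le_2_imp_le_1:
  assumes "le \<rho> 2 \<alpha> \<beta>"
  shows "le \<rho> 1 \<alpha> \<beta>"
proof -
  have "reflects \<rho> \<alpha> \<beta> (\<lambda>y. le \<rho> 1 y \<beta>) (\<lambda>y. le \<rho> 1 y \<alpha>)"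
    using assms le_2_iff_reflects[of \<rho> \<alpha> \<beta>] by simp
  from reflects_mono[OF this order_refl] show ?thesis
    using le_imp_less_eq[OF assms] le_1_iff_reflects[of \<rho> \<alpha> \<beta>] by simp
qed

lemma le_imp_le_1:
  assumes "le \<rho> k \<alpha> \<beta>"
  shows "le \<rho> 1 \<alpha> \<beta>"
proof -
  have "k = 1 \<or> k = 2" using assms le_unfold[of \<rho> k \<alpha> \<beta>] by auto
  then show ?thesis using assms le_2_imp_le_1 by metis
qed

text \<open>A smaller right end leaves fewer sets \<open>Y\<close> to reflect.\<close>

lemma le_1_antimono:
  assumes "le \<rho> 1 \<alpha> \<beta>" "\<alpha> \<le> \<delta>" "\<delta> \<le> \<beta>"
  shows "le \<rho> 1 \<alpha> \<delta>"
proof -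
  have "reflects \<rho> \<alpha> \<beta> (\<lambda>_. True) (\<lambda>_. True)"
    using assms(1) le_1_iff_reflects[of \<rho> \<alpha> \<beta>] by simp
  from reflects_mono[OF this assms(3)] show ?thesis
    using assms(2) le_1_iff_reflects[of \<rho> \<alpha> \<delta>] by simp
qed

text \<open>\<open>Y\<close> lies in the empty interval \<open>{\<alpha>..<\<alpha>}\<close>, so the
  identity serves.\<close>

lemma reflects_refl: "reflects \<rho> \<alpha> \<alpha> Q R"
  unfolding reflects_def using covering_id by fastforce

lemma le_refl: "k \<in> {1, 2} \<Longrightarrow> le \<rho> k \<alpha> \<alpha>"
  using le_1_iff_reflects[of \<rho> \<alpha> \<alpha>] le_2_iff_reflects[of \<rho> \<alpha> \<alpha>]
  by (auto simp: reflects_refl simp del: One_nat_def)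

section \<open>Relations between blocks\<close>

lemma shift_props:
  fixes p q :: "'a::infinite ord"
  assumes "q \<le> v"
  shows "shift p q (shift q p v) = v" "p \<le> shift q p v"
  using ord_diff_ex[OF assms] by auto

lemma closed_set_Un: "closed_set \<rho> A \<Longrightarrow> closed_set \<rho> B \<Longrightarrow> closed_set \<rho> (A \<union> B)"
  unfolding closed_set_def by blast

lemma closed_set_singleton:
  fixes \<rho> :: "'a::infinite ord"
  assumes "0 < \<rho>" "\<rho> dvd x"
  shows "closed_set \<rho> {x}"
  unfolding closed_set_def
proof (intro allI impI, elim conjE exE)
  fix \<sigma> \<xi> assume *: "\<rho> dvd \<sigma>" "\<xi> < \<rho>" "\<sigma> + \<xi> \<in> {x}"
  then have "\<rho> dvd \<sigma> + \<xi>" using assms by simp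
  then have "\<xi> = 0" using * by (auto simp: dvd_def[of \<rho> \<sigma>] dvd_add_mult_iff)
  then show "\<sigma> \<in> {x}" using * by simp
qed

lemma closed_set_block:
  fixes \<rho> :: "'a::infinite ord"
  assumes "\<epsilon> < \<rho>"
  shows "closed_set \<rho> {\<rho> * \<zeta>, \<rho> * \<zeta> + \<epsilon>}"
  unfolding closed_set_def
proof (intro allI impI, elim conjE exE)
  fix \<sigma> \<xi> assume *: "\<rho> dvd \<sigma>" "\<xi> < \<rho>" "\<sigma> + \<xi> \<in> {\<rho> * \<zeta>, \<rho> * \<zeta> + \<epsilon>}"
  obtain \<eta> where \<eta>: "\<sigma> = \<rho> * \<eta>" using *(1) by (auto simp: dvd_def)
  \<comment> \<open>The base itself counts as having remainder \<open>0\<close>, so uniqueness of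
    the quotient treats both elements alike.\<close>
  have "\<exists>\<delta><\<rho>. \<rho> * \<eta> + \<xi> = \<rho> * \<zeta> + \<delta>"
    using *(3) assms by (auto simp: \<eta> intro: exI[of _ 0] le_less_trans[OF zero_le_ord])
  then have "\<eta> = \<zeta>" using ord_division_unique(1)[OF _ *(2)] by blast
  then show "\<sigma> \<in> {\<rho> * \<zeta>, \<rho> * \<zeta> + \<epsilon>}" using \<eta> by simp
qed

lemma dvd_less_imp_add_le:
  fixes \<rho> :: "'a::infinite ord"
  assumes "\<rho> dvd x" "\<rho> dvd y" "x < y"
  shows "x + \<rho> \<le> y"
proof -
  obtain \<zeta> \<eta> where *: "x = \<rho> * \<zeta>" "y = \<rho> * \<eta>" using assms by (auto simp: dvd_def)
  have "\<zeta> < \<eta>"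
  proof (rule ccontr)
    assume "\<not> \<zeta> < \<eta>"
    then have "y \<le> x" unfolding * by (metis le_add_ord le_less linorder_not_less mult_add_one_le order_trans)
    then show False using assms(3) by simp
  qed
  then show ?thesis unfolding * by (rule mult_add_one_le)
qed

lemma covering_dvd:
  fixes \<rho> :: "'a::infinite ord"
  assumes "0 < \<rho>" "covering \<rho> L S g" "x \<in> S" "\<rho> dvd x"
  shows "\<rho> dvd g x"
  using covering_f_op_iff[OF assms(2,3,3,1)] assms(1,4) by (simp add: f_op_zero_iff)

lemma le_not_dvd_imp_eq:
  fixes \<rho> :: "'a::infinite ord"
  assumes "0 < \<rho>" "\<not> \<rho> dvd \<alpha>" "le \<rho> k \<alpha> \<beta>"
  shows "\<alpha> = \<beta>"
proof (rule ccontr)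
  assume "\<alpha> \<noteq> \<beta>"
  then have "\<alpha> < \<beta>" using le_imp_less_eq[OF assms(3)] by simp
  obtain \<zeta> \<epsilon> where \<alpha>: "\<alpha> = \<rho> * \<zeta> + \<epsilon>" "\<epsilon> < \<rho>" using ord_division[OF assms(1)] by blast
  have "\<epsilon> \<noteq> 0" using assms(2) \<alpha> by (auto simp: dvd_def)
  then have "\<rho> * \<zeta> < \<alpha>" using add_ord_strict_mono[of 0 \<epsilon> "\<rho> * \<zeta>"] by (simp add: \<alpha> ord_zero_less_iff)
  have r: "reflects \<rho> \<alpha> \<beta> (\<lambda>_. True) (\<lambda>_. True)"
    using le_imp_le_1[OF assms(3)] le_1_iff_reflects[of \<rho> \<alpha> \<beta>] by simp
  have "closed_set \<rho> ({\<rho> * \<zeta>} \<union> {\<alpha>})" using closed_set_block[OF \<alpha>(2)] \<alpha>(1) by (simp add: insert_commute)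
  from reflectsE[OF r _ _ _ _ this] obtain g where
    g: "covering \<rho> (le \<rho>) ({\<rho> * \<zeta>} \<union> {\<alpha>}) g" "g (\<rho> * \<zeta>) = \<rho> * \<zeta>" "g \<alpha> < \<alpha>"
    using \<open>\<rho> * \<zeta> < \<alpha>\<close> \<open>\<alpha> < \<beta>\<close> by auto
  \<comment> \<open>\<open>\<alpha>\<close> is determined by the base of its block. As the covering
    fixes that base, it also fixes \<open>\<alpha>\<close> and cannot move it down.\<close>
  have "f_op \<rho> \<epsilon> (\<rho> * \<zeta>) = \<alpha>" by (simp add: f_op_mult \<alpha>)
  then have "\<alpha> = g \<alpha>" using covering_f_op_iff[OF g(1), of "\<rho> * \<zeta>" \<alpha> \<epsilon>] \<alpha>(2) g(2) by simp
  then show False using g(3) by simp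
qed

text \<open>With \<open>p\<close> in \<open>X\<close>, the reflection of \<open>p + \<rho>\<close>
  would be a multiple of \<open>\<rho>\<close> strictly between \<open>p\<close> and
  \<open>p + \<rho>\<close>.\<close>

lemma le_add_imp_eq:
  fixes \<rho> :: "'a::infinite ord"
  assumes "0 < \<rho>" "\<rho> dvd p" "le \<rho> k (p + \<rho>) \<beta>"
  shows "p + \<rho> = \<beta>"
proof (rule ccontr)
  assume "p + \<rho> \<noteq> \<beta>"
  then have less: "p + \<rho> < \<beta>" using le_imp_less_eq[OF assms(3)] by simp
  have less': "p < p + \<rho>" using add_ord_strict_mono[OF assms(1), of p] by simp
  have dvd: "\<rho> dvd p + \<rho>"
    using assms(1,2) by (auto simp: dvd_add_ord_iff dvd_def simp flip: mult_ord_add_one)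
  have r: "reflects \<rho> (p + \<rho>) \<beta> (\<lambda>_. True) (\<lambda>_. True)"
    using le_imp_le_1[OF assms(3)] le_1_iff_reflects[of \<rho> "p + \<rho>" \<beta>] by simp
  have "closed_set \<rho> ({p} \<union> {p + \<rho>})"
    using assms dvd by (intro closed_set_Un closed_set_singleton)
  from reflectsE[OF r _ _ _ _ this] obtain g where
    g: "covering \<rho> (le \<rho>) ({p} \<union> {p + \<rho>}) g" "g p = p" "g (p + \<rho>) < p + \<rho>"
    using less less' by auto
  have "p < g (p + \<rho>)" using covering_less[OF g(1), of p "p + \<rho>"] less' g(2) by simp
  moreover have "\<rho> dvd g (p + \<rho>)" using covering_dvd[OF assms(1) g(1)] dvd by simp
  ultimately show False using dvd_less_imp_add_le assms(2) g(3) by (meson not_le)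
qed

text \<open>For \<open>\<beta> > 0\<close> the set \<open>{0}\<close> would have to be reflected
  below \<open>0\<close>.\<close>

lemma le_0_imp_eq:
  fixes \<rho> :: "'a::infinite ord"
  assumes "0 < \<rho>" "le \<rho> k 0 \<beta>"
  shows "\<beta> = 0"
proof (rule ccontr)
  assume "\<beta> \<noteq> 0"
  have r: "reflects \<rho> 0 \<beta> (\<lambda>_. True) (\<lambda>_. True)"
    using le_imp_le_1[OF assms(2)] le_1_iff_reflects[of \<rho> 0 \<beta>] by simp
  have "\<rho> dvd 0" unfolding dvd_def by (metis mult_ord_zero_right)
  then have "closed_set \<rho> ({} \<union> {0})" using closed_set_singleton[OF assms(1)] by simp
  from reflectsE[OF r _ _ _ _ this] show False using \<open>\<beta> \<noteq> 0\<close> by (auto simp: ord_zero_less_iff)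
qed

text \<open>Reflect below \<open>\<beta>\<close> first, then reflect the resulting set below
  \<open>\<alpha>\<close>, and compose the two coverings.\<close>

lemma le_1_trans:
  fixes \<rho> :: "'a::infinite ord"
  assumes "0 < \<rho>" "le \<rho> 1 \<alpha> \<beta>" "le \<rho> 1 \<beta> \<gamma>"
  shows "le \<rho> 1 \<alpha> \<gamma>"
proof -
  have \<alpha>\<beta>: "\<alpha> \<le> \<beta>" "\<beta> \<le> \<gamma>" using assms by (auto dest: le_imp_less_eq)
  have r: "reflects \<rho> \<alpha> \<beta> (\<lambda>_. True) (\<lambda>_. True)" "reflects \<rho> \<beta> \<gamma> (\<lambda>_. True) (\<lambda>_. True)"
    using assms(2,3) le_1_iff_reflects[of \<rho> \<alpha> \<beta>] le_1_iff_reflects[of \<rho> \<beta> \<gamma>] by simp_all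
  have "reflects \<rho> \<alpha> \<gamma> (\<lambda>_. True) (\<lambda>_. True)" unfolding reflects_def
  proof (intro allI impI, elim conjE)
    fix X Y assume *: "finite X" "X \<subseteq> {..<\<alpha>}" "finite Y" "Y \<subseteq> {\<alpha>..<\<gamma>}" "closed_set \<rho> (X \<union> Y)"
    have X\<beta>: "X \<subseteq> {..<\<beta>}" using *(2) \<alpha>\<beta> by fastforce
    have XY: "(X \<union> Y \<inter> {..<\<beta>}) \<union> (Y \<inter> {\<beta>..}) = X \<union> Y" by (auto simp: not_less)
    have "finite (X \<union> Y \<inter> {..<\<beta>})" "X \<union> Y \<inter> {..<\<beta>} \<subseteq> {..<\<beta>}" "finite (Y \<inter> {\<beta>..})"
      "Y \<inter> {\<beta>..} \<subseteq> {\<beta>..<\<gamma>}" "closed_set \<rho> ((X \<union> Y \<inter> {..<\<beta>}) \<union> (Y \<inter> {\<beta>..}))"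
      using * X\<beta> unfolding XY by auto
    from reflectsE[OF r(2) this] obtain g where g: "covering \<rho> (le \<rho>) (X \<union> Y) g"
      "\<And>x. x \<in> X \<union> Y \<inter> {..<\<beta>} \<Longrightarrow> g x = x" "g ` (Y \<inter> {\<beta>..}) \<subseteq> {..<\<beta>}"
      unfolding XY by metis
    \<comment> \<open>\<open>W\<close> is split at \<open>\<alpha>\<close> and not into
      \<open>X\<close> and the image of \<open>Y\<close>: the first covering may already send points
      of \<open>Y\<close> below \<open>\<alpha>\<close>, and these are fixed by the second
      one.\<close>
    define W where "W = g ` (X \<union> Y)"
    have W\<beta>: "W \<subseteq> {..<\<beta>}"
    proof
      fix w assume "w \<in> W"
      then obtain x where x: "x \<in> X \<union> Y" "w = g x" by (auto simp: W_def)
      show "w \<in> {..<\<beta>}"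
      proof (cases "x < \<beta>")
        case True
        then show ?thesis using x g(2)[of x] by auto
      next
        case False
        then have "x \<in> Y \<inter> {\<beta>..}" using x X\<beta> by auto
        then show ?thesis using x g(3) by blast
      qed
    qed
    have WW: "W \<inter> {..<\<alpha>} \<union> W \<inter> {\<alpha>..} = W" by (auto simp: not_less)
    have "closed_set \<rho> W" unfolding W_def using closed_set_covering[OF assms(1) *(5) g(1)] .
    then have "finite (W \<inter> {..<\<alpha>})" "W \<inter> {..<\<alpha>} \<subseteq> {..<\<alpha>}" "finite (W \<inter> {\<alpha>..})"
      "W \<inter> {\<alpha>..} \<subseteq> {\<alpha>..<\<beta>}" "closed_set \<rho> (W \<inter> {..<\<alpha>} \<union> W \<inter> {\<alpha>..})"
      using *(1,3) W\<beta> unfolding WW by (auto simp: W_def)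
    from reflectsE[OF r(1) this] obtain h where h: "covering \<rho> (le \<rho>) W h"
      "\<And>x. x \<in> W \<inter> {..<\<alpha>} \<Longrightarrow> h x = x" "h ` (W \<inter> {\<alpha>..}) \<subseteq> {..<\<alpha>}"
      unfolding WW by metis
    have "covering \<rho> (le \<rho>) (X \<union> Y) (h \<circ> g)"
      using g(1) h(1) unfolding W_def by (rule covering_comp)
    moreover have "(h \<circ> g) x = x" if "x \<in> X" for x
    proof -
      have "x \<in> W" using that g(2)[of x] unfolding W_def by (metis UnI1 image_eqI)
      then show ?thesis using that *(2) g(2)[of x] h(2)[of x] by auto
    qed
    moreover have "(h \<circ> g) y < \<alpha>" if "y \<in> Y" for y
    proof -
      have w: "g y \<in> W" using that unfolding W_def by blast
      show ?thesis
      proof (cases "g y < \<alpha>")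
        case True
        then show ?thesis using h(2)[of "g y"] w by simp
      next
        case False
        then show ?thesis using h(3) w by (auto simp: not_less)
      qed
    qed
    ultimately show "\<exists>g. covering \<rho> (le \<rho>) (X \<union> Y) g \<and> (\<forall>x\<in>X. g x = x) \<and> g ` Y \<subseteq> {..<\<alpha>} \<and>
        (\<forall>y\<in>Y. True \<longrightarrow> True)"
      by (intro exI[of _ "h \<circ> g"]) auto
  qed
  then show ?thesis using \<alpha>\<beta> le_1_iff_reflects[of \<rho> \<alpha> \<gamma>] by simp
qed

text \<open>A finite \<open>Y\<close> below \<open>\<alpha>\<close> already lies below one of the
  given \<open>v\<close>, and reflection from \<open>v\<close> suffices.\<close>

lemma le_1_limit:
  fixes \<rho> :: "'a::infinite ord"
  assumes "u < \<alpha>" "\<And>\<gamma>. \<gamma> < \<alpha> \<Longrightarrow> \<exists>v. \<gamma> < v \<and> v < \<alpha> \<and> le \<rho> 1 u v"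
  shows "le \<rho> 1 u \<alpha>"
proof -
  have "reflects \<rho> u \<alpha> (\<lambda>_. True) (\<lambda>_. True)" unfolding reflects_def
  proof (intro allI impI, elim conjE)
    fix X Y assume *: "finite X" "X \<subseteq> {..<u}" "finite Y" "Y \<subseteq> {u..<\<alpha>}" "closed_set \<rho> (X \<union> Y)"
    \<comment> \<open>Including \<open>u\<close> gives the maximum a meaning when \<open>Y\<close>
      is empty.\<close>
    define m where "m = Max (insert u Y)"
    have m: "m < \<alpha>" "\<And>y. y \<in> Y \<Longrightarrow> y \<le> m" using * assms(1) unfolding m_def by (auto simp del: Max_insert)
    from assms(2)[OF m(1)] obtain v where v: "m < v" "le \<rho> 1 u v" by blast
    have r: "reflects \<rho> u v (\<lambda>_. True) (\<lambda>_. True)"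
      using v(2) le_1_iff_reflects[of \<rho> u v] by simp
    have "Y \<subseteq> {u..<v}" using *(4) m(2) v(1) by fastforce
    from reflectsE[OF r *(1-3) this *(5)]
    show "\<exists>g. covering \<rho> (le \<rho>) (X \<union> Y) g \<and> (\<forall>x\<in>X. g x = x) \<and> g ` Y \<subseteq> {..<u} \<and>
        (\<forall>y\<in>Y. True \<longrightarrow> True)" by metis
  qed
  then show ?thesis using assms(1) le_1_iff_reflects[of \<rho> u \<alpha>] by simp
qed

section \<open>Transfer along a shift\<close>

text \<open>Conjugates \<open>g\<close> by the shift from \<open>q\<close> on and takes the identity
  below \<open>q\<close>. The functions \<open>f_op\<close> never cross \<open>q\<close>, and
  relations above \<open>q\<close> transfer by the induction hypothesis. Only relations from below
  \<open>q\<close> to above it remain, and these are the assumption \<open>low\<close>.\<close>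

lemma covering_shift:
  fixes \<rho> p q :: "'a::infinite ord"
  assumes \<rho>: "0 < \<rho>" "\<rho> dvd p" "\<rho> dvd q"
    and IH: "\<And>k c d. d < b \<Longrightarrow> le \<rho> k (p + c) (p + d) \<longleftrightarrow> le \<rho> k (q + c) (q + d)"
    and S: "S \<subseteq> {..<q + b}"
    and g: "covering \<rho> (le \<rho>) (shift q p ` (S \<inter> {q..})) g"
    and gim: "g ` shift q p ` (S \<inter> {q..}) \<subseteq> {p..<p + b}"
    and low: "\<And>k u v. k \<in> {1, 2} \<Longrightarrow> u \<in> S \<Longrightarrow> u < q \<Longrightarrow> v \<in> S \<Longrightarrow> q \<le> v \<Longrightarrow> le \<rho> k u v \<Longrightarrow>
      le \<rho> k u (shift p q (g (shift q p v)))"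
  shows "covering \<rho> (le \<rho>) S (\<lambda>v. if v < q then v else shift p q (g (shift q p v)))"
    (is "covering _ _ _ ?G")
proof -
  \<comment> \<open>Coordinates relative to the two bases: if \<open>g\<close> moves
    \<open>p + c\<close> to \<open>p + d\<close>, the new map moves \<open>q + c\<close> to
    \<open>q + d\<close>.\<close>
  have up: "\<exists>c d. v = q + c \<and> c < b \<and> p + c \<in> shift q p ` (S \<inter> {q..}) \<and>
      g (p + c) = p + d \<and> d < b \<and> ?G v = q + d"
    if v: "v \<in> S" "\<not> v < q" for v
  proof -
    have "q \<le> v" using v by simp
    then obtain c where c: "v = q + c" using ord_diff_ex by blast
    have "p + c \<in> shift q p ` (S \<inter> {q..})"
      using v c by (intro image_eqI[of _ _ v]) auto
    moreover from this have "g (p + c) \<in> {p..<p + b}" using gim by blast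
    moreover from this obtain d where "g (p + c) = p + d" using ord_diff_ex[of p] by auto
    moreover have "c < b" using S v c by auto
    ultimately show ?thesis using c v by auto
  qed
  show ?thesis unfolding covering_def
  proof (intro conjI ballI allI impI strict_mono_onI)
    fix x y assume xy: "x \<in> S" "y \<in> S" "x < y"
    show "?G x < ?G y"
    proof (cases "x < q")
      case True
      show ?thesis
      proof (cases "y < q")
        case False
        with up[OF xy(2)] obtain d where "?G y = q + d" by blast
        then show ?thesis using True le_add_ord[of q d] by (simp add: less_le_trans)
      qed (use xy True in simp)
    next
      case False
      then have "\<not> y < q" using xy by simp
      from up[OF xy(1) False] obtain c d where 1: "x = q + c" "p + c \<in> shift q p ` (S \<inter> {q..})"
        "g (p + c) = p + d" "?G x = q + d" by blast
      from up[OF xy(2) \<open>\<not> y < q\<close>] obtain c' d' where 2: "y = q + c'"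
        "p + c' \<in> shift q p ` (S \<inter> {q..})" "g (p + c') = p + d'" "?G y = q + d'" by blast
      have "p + c < p + c'" using xy 1 2 by simp
      from covering_less[OF g 1(2) 2(2) this] show ?thesis unfolding 1(4) 2(4) by (simp add: 1 2)
    qed
  next
    fix x y \<xi> assume xy: "x \<in> S" "y \<in> S" "\<xi> < \<rho>"
    have ge: "q \<le> ?G v" if "v \<in> S" "\<not> v < q" for v using up[OF that] by auto
    show "f_op \<rho> \<xi> x = y \<longleftrightarrow> f_op \<rho> \<xi> (?G x) = ?G y"
    proof (cases "x < q")
      case True
      \<comment> \<open>For \<open>y\<close> from \<open>q\<close> on, the equation therefore fails
        both before and after the map is applied.\<close>
      then have "f_op \<rho> \<xi> x < q" by (rule f_op_less[OF \<rho>(1,3) xy(3)])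
      then show ?thesis using True ge[OF xy(2)] by (cases "y < q") auto
    next
      case False
      from up[OF xy(1) False] obtain c d where 1: "x = q + c" "p + c \<in> shift q p ` (S \<inter> {q..})"
        "g (p + c) = p + d" "?G x = q + d" by blast
      show ?thesis
      proof (cases "y < q")
        case True
        then show ?thesis using f_op_ge[OF \<rho>(1,3), of x \<xi>] f_op_ge[OF \<rho>(1,3), of "?G x" \<xi>] 
            ge[OF xy(1) False] False by (auto simp: not_less)
      next
        case False
        from up[OF xy(2) False] obtain c' d' where 2: "y = q + c'"
          "p + c' \<in> shift q p ` (S \<inter> {q..})" "g (p + c') = p + d'" "?G y = q + d'" by blast
        show ?thesis unfolding 1(4) 2(4) using covering_f_op_iff[OF g 1(2) 2(2) xy(3)]
          by (simp add: 1 2 f_op_add \<rho>)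
      qed
    qed
  next
    fix x y k assume xy: "x \<in> S" "y \<in> S" "k \<in> {1, 2::nat}" "le \<rho> k x y"
    show "le \<rho> k (?G x) (?G y)"
    proof (cases "x < q")
      case True
      then show ?thesis using low[OF xy(3,1) True xy(2) _ xy(4)] xy by (cases "y < q") auto
    next
      case False
      then have "\<not> y < q" using le_imp_less_eq[OF xy(4)] by simp
      from up[OF xy(1) False] obtain c d where 1: "x = q + c" "p + c \<in> shift q p ` (S \<inter> {q..})"
        "g (p + c) = p + d" "?G x = q + d" by blast
      from up[OF xy(2) \<open>\<not> y < q\<close>] obtain c' d' where 2: "y = q + c'" "c' < b" "d' < b"
        "p + c' \<in> shift q p ` (S \<inter> {q..})" "g (p + c') = p + d'" "?G y = q + d'" by blast
      have "le \<rho> k (p + c) (p + c')" using xy(4) IH[OF 2(2)] 1 2 by simp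
      from covering_le[OF g 1(2) 2(4) xy(3) this] show ?thesis
        unfolding 1(4) 2(6) using IH[OF 2(3)] by (simp add: 1 2)
    qed
  qed
qed

text \<open>The fixed point \<open>p\<close> is a marker: the base of the block of \<open>v\<close>
  goes to a multiple of \<open>\<rho>\<close> above \<open>p\<close>, hence to at least
  \<open>p + \<rho>\<close>. This keeps reflected sets within the range that can be shifted
  back.\<close>

lemma covering_ge_add:
  fixes \<rho> p :: "'a::infinite ord"
  assumes \<rho>: "0 < \<rho>" "\<rho> dvd p" and A: "closed_set \<rho> A" "A \<subseteq> {p + \<rho>..}"
    and g: "covering \<rho> L (insert p A) g" "g p = p" and v: "v \<in> A"
  shows "p + \<rho> \<le> g v"
proof -
  have less': "p < p + \<rho>" using add_ord_strict_mono[OF \<rho>(1), of p] by simp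
  have dvd: "\<rho> dvd p + \<rho>"
    using \<rho> by (auto simp: dvd_add_ord_iff dvd_def simp flip: mult_ord_add_one)
  obtain \<zeta> \<epsilon> where \<zeta>: "v = \<rho> * \<zeta> + \<epsilon>" "\<epsilon> < \<rho>" using ord_division[OF \<rho>(1)] by blast
  have base: "\<rho> * \<zeta> \<in> A" using A(1) v \<zeta> unfolding closed_set_def dvd_def by blast
  then have "p < \<rho> * \<zeta>" using A(2) less' by fastforce
  from covering_less[OF g(1) _ _ this] have "p < g (\<rho> * \<zeta>)" using base g(2) by simp
  moreover have "\<rho> dvd g (\<rho> * \<zeta>)" using covering_dvd[OF \<rho>(1) g(1)] base by (auto simp: dvd_def)
  ultimately have "p + \<rho> \<le> g (\<rho> * \<zeta>)" using dvd_less_imp_add_le \<rho>(2) by blast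
  also have "\<dots> \<le> g v" using covering_less_eq[OF g(1), of "\<rho> * \<zeta>" v] base v \<zeta> by simp
  finally show ?thesis .
qed

text \<open>Trivial \<open>Q\<close> and \<open>R\<close> give the transfer of
  \<open>\<le>\<^sub>1\<close>. With conditions on \<open>le \<rho> 1\<close> the lemma gives the
  downward clause of \<open>\<le>\<^sub>2\<close>.\<close>

lemma reflects_shift:
  fixes \<rho> p p' q :: "'a::infinite ord"
  assumes \<rho>: "0 < \<rho>" "\<rho> dvd p'" "p = p' + \<rho>" "\<rho> dvd q"
    and IH: "\<And>k c d. d < b \<Longrightarrow> le \<rho> k (p + c) (p + d) \<longleftrightarrow> le \<rho> k (q + c) (q + d)"
    and H: "not_le_sets \<rho> 2 {..<q} {q..<q + b}"
    and ab: "a \<le> b" and r: "reflects \<rho> (p + a) (p + b) Q R"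
    and Q: "\<And>c. a \<le> c \<Longrightarrow> c < b \<Longrightarrow> Q' (q + c) \<Longrightarrow> Q (p + c)"
    and R: "\<And>c. c < a \<Longrightarrow> R (p + c) \<Longrightarrow> R' (q + c)"
  shows "reflects \<rho> (q + a) (q + b) Q' R'"
  unfolding reflects_def
proof (intro allI impI, elim conjE)
  fix X Y assume *: "finite X" "X \<subseteq> {..<q + a}" "finite Y" "Y \<subseteq> {q + a..<q + b}" "closed_set \<rho> (X \<union> Y)"
  have p'p: "p' < p" using add_ord_strict_mono[OF \<rho>(1), of p'] \<rho>(3) by simp
  have dvd: "\<rho> dvd p"
    using \<rho> by (auto simp: dvd_add_ord_iff dvd_def simp flip: mult_ord_add_one)
  have pab: "p + a \<le> p + b" "q + a \<le> q + b" using ab by (metis add_ord_less_cancel not_le)+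
  define A where "A = shift q p ` ((X \<union> Y) \<inter> {q..})"
  \<comment> \<open>The part of \<open>X\<close> below \<open>q\<close> is replaced by the single
    marker \<open>p'\<close>, the multiple of \<open>\<rho>\<close> just before
    \<open>p\<close>.\<close>
  define X1 where "X1 = insert p' (shift q p ` (X \<inter> {q..}))"
  define Y1 where "Y1 = shift q p ` Y"
  have Yq: "Y \<subseteq> {q..}" using *(4) order_trans[OF le_add_ord[of q a]] by (auto simp: subset_iff)
  then have XY1: "X1 \<union> Y1 = insert p' A" unfolding X1_def Y1_def A_def by blast
  have sX: "shift q p x \<in> {p..<p + a}" if "x \<in> X" "q \<le> x" for x
    using ord_diff_ex[OF that(2)] that(1) *(2) by auto
  have sY: "shift q p x \<in> {p + a..<p + b}" if "x \<in> Y" for x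
  proof -
    have "q \<le> x" using Yq that by auto
    then obtain c where c: "x = q + c" using ord_diff_ex by blast
    have "q + c \<in> {q + a..<q + b}" using *(4) that c by blast
    then show ?thesis by (simp add: c) (metis add_ord_less_cancel not_le)
  qed
  have "finite X1" "finite Y1" using *(1,3) by (simp_all add: X1_def Y1_def)
  moreover have "X1 \<subseteq> {..<p + a}"
    using sX p'p le_add_ord[of p a] unfolding X1_def by (auto intro: less_le_trans)
  moreover have "Y1 \<subseteq> {p + a..<p + b}" using sY unfolding Y1_def by blast
  moreover have clA: "closed_set \<rho> A" unfolding A_def by (intro closed_set_shift \<rho> dvd *)
  then have "closed_set \<rho> (X1 \<union> Y1)"
    unfolding XY1 using closed_set_Un[OF closed_set_singleton[OF \<rho>(1,2)] clA] by simp
  ultimately obtain g where g: "covering \<rho> (le \<rho>) (insert p' A) g" "\<And>x. x \<in> X1 \<Longrightarrow> g x = x"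
    "g ` Y1 \<subseteq> {..<p + a}" "\<And>y. y \<in> Y1 \<Longrightarrow> Q y \<Longrightarrow> R (g y)"
    using reflectsE[OF r, of X1 Y1] unfolding XY1 by metis
  have Ap: "A \<subseteq> {p..}" unfolding A_def using shift_props(2)[of q] by auto
  have gA: "p \<le> g v" if "v \<in> A" for v
    using covering_ge_add[OF \<rho>(1,2) clA _ g(1) _ that] Ap g(2) unfolding \<rho>(3) X1_def by blast
  have gY: "\<exists>d<a. g (shift q p y) = p + d" if "y \<in> Y" for y
  proof -
    have "shift q p y \<in> A" using that Yq unfolding A_def by blast
    then obtain d where "g (shift q p y) = p + d" using gA ord_diff_ex by metis
    moreover have "g (shift q p y) \<in> {..<p + a}" using g(3) that unfolding Y1_def by blast
    ultimately show ?thesis by auto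
  qed
  have gX: "g (shift q p x) = shift q p x" if "x \<in> X" "q \<le> x" for x
    using g(2) that unfolding X1_def by blast
  define G where "G v = (if v < q then v else shift p q (g (shift q p v)))" for v
  have GX: "G x = x" if "x \<in> X" for x
    using gX[OF that] shift_props(1)[of q x p] by (simp add: G_def not_less)
  have GY: "\<exists>d<a. g (shift q p y) = p + d \<and> G y = q + d" if "y \<in> Y" for y
    using gY[OF that] Yq that by (auto simp: G_def)
  have "covering \<rho> (le \<rho>) (X \<union> Y) G" unfolding G_def
  proof (rule covering_shift[OF \<rho>(1) dvd \<rho>(4), where b = b])
    show "X \<union> Y \<subseteq> {..<q + b}" using *(2,4) pab(2) by fastforce
    show "covering \<rho> (le \<rho>) (shift q p ` ((X \<union> Y) \<inter> {q..})) g"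
      using covering_subset[OF g(1)] unfolding A_def by blast
    show "g ` shift q p ` ((X \<union> Y) \<inter> {q..}) \<subseteq> {p..<p + b}"
    proof
      fix w assume "w \<in> g ` shift q p ` ((X \<union> Y) \<inter> {q..})"
      then obtain x where x: "x \<in> X \<union> Y" "q \<le> x" "w = g (shift q p x)" by auto
      then have "w < p + a"
        using gX[of x] sX[of x] gY[of x] by (cases "x \<in> X") auto
      moreover have "p \<le> w" using x gA unfolding A_def by blast
      ultimately show "w \<in> {p..<p + b}" using pab by auto
    qed
    fix k u v assume **: "k \<in> {1, 2}" "u \<in> X \<union> Y" "u < q" "v \<in> X \<union> Y" "q \<le> v" "le \<rho> k u v"
    have Gv: "G v = shift p q (g (shift q p v))" using **(5) by (simp add: G_def leD)
    show "le \<rho> k u (shift p q (g (shift q p v)))"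
    proof (cases "v \<in> X")
      case True
      then show ?thesis using GX[OF True] **(6) Gv by simp
    next
      case False
      then have v: "v \<in> Y" using ** by blast
      then obtain d where d: "d < a" "G v = q + d" using GY by blast
      have vq: "q + a \<le> v" "v < q + b" using v *(4) by auto
      \<comment> \<open>Here \<open>u\<close> stays fixed while \<open>v\<close> moves down to
        \<open>q + d\<close>. By \<open>H\<close> only \<open>\<le>\<^sub>1\<close> can hold from
        \<open>u\<close> to \<open>v\<close>, and it survives because
        \<open>u \<le> q + d \<le> v\<close>.\<close>
      have "k \<noteq> 2" using H **(3,5,6) vq(2) unfolding not_le_sets_def by auto
      then have "k = 1" using **(1) by blast
      moreover have "u \<le> q + d" using less_le_trans[OF **(3) le_add_ord[of q d]] by simp
      moreover have "q + d \<le> v" using less_le_trans[OF add_ord_strict_mono[OF d(1)] vq(1)] by simp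
      ultimately show ?thesis using le_1_antimono **(6) d(2) Gv by metis
    qed
  qed (rule IH)
  moreover have "G ` Y \<subseteq> {..<q + a}" using GY by fastforce
  moreover have "R' (G y)" if "y \<in> Y" "Q' y" for y
  proof -
    have "q \<le> y" using Yq that by auto
    then obtain c where c: "y = q + c" using ord_diff_ex by blast
    have "q + c \<in> {q + a..<q + b}" using *(4) that(1) c by blast
    then have "a \<le> c" "c < b" by (simp_all) (metis add_ord_less_cancel not_le)
    then have "Q (p + c)" using Q that c by blast
    moreover have "p + c \<in> Y1" using that c unfolding Y1_def by (intro image_eqI[of _ _ y]) auto
    ultimately have "R (g (p + c))" using g(4) by blast
    moreover obtain d where "d < a" "g (shift q p y) = p + d" "G y = q + d" using GY[OF \<open>y \<in> Y\<close>] by blast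
    ultimately show ?thesis using R c by simp
  qed
  ultimately show "\<exists>g. covering \<rho> (le \<rho>) (X \<union> Y) g \<and> (\<forall>x\<in>X. g x = x) \<and> g ` Y \<subseteq> {..<q + a} \<and>
      (\<forall>y\<in>Y. Q' y \<longrightarrow> R' (g y))"
    using GX by (intro exI[of _ G]) simp
qed

section \<open>Transfer of the upward clause of \<open>\<le>\<^sub>2\<close>\<close>

lemma covering_factor:
  assumes g: "covering \<rho> L S g" and h: "covering \<rho> L S h"
    and le: "\<And>k x y. k \<in> {1, 2} \<Longrightarrow> x \<in> S \<Longrightarrow> y \<in> S \<Longrightarrow> L k (g x) (g y) \<Longrightarrow> L k (h x) (h y)"
  shows "covering \<rho> L (g ` S) (h \<circ> inv_into S g)"
proof -
  have inj: "inj_on g S" using g unfolding covering_def by (blast intro: strict_mono_on_imp_inj_on)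
  have [simp]: "inv_into S g (g x) = x" if "x \<in> S" for x using inv_into_f_f[OF inj that] .
  have less: "x < y" if "x \<in> S" "y \<in> S" "g x < g y" for x y
    using covering_less_eq[OF g that(2,1)] that(3) by (meson not_le)
  show ?thesis unfolding covering_def
  proof (intro conjI ballI allI impI strict_mono_onI)
    fix x y assume "x \<in> g ` S" "y \<in> g ` S" "x < y"
    then show "(h \<circ> inv_into S g) x < (h \<circ> inv_into S g) y"
      using less covering_less[OF h] by auto
  next
    fix x y \<xi> assume "x \<in> g ` S" "y \<in> g ` S" "\<xi> < \<rho>"
    then show "f_op \<rho> \<xi> x = y \<longleftrightarrow>
        f_op \<rho> \<xi> ((h \<circ> inv_into S g) x) = (h \<circ> inv_into S g) y"
      using covering_f_op_iff[OF h] covering_f_op_iff[OF g] by auto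
  next
    fix x y k assume "x \<in> g ` S" "y \<in> g ` S" "k \<in> {1, 2::nat}" "L k x y"
    \<comment> \<open>Coverings preserve relations but need not reflect them: a relation between
      values of \<open>g\<close> may be new. The assumption \<open>le\<close> says that
      \<open>h\<close> has it as well.\<close>
    then show "L k ((h \<circ> inv_into S g) x) ((h \<circ> inv_into S g) y)" using le by auto
  qed
qed

text \<open>
  Since there are only finitely many isomorphism types of coverings of \<open>X \<union> Y\<close>, one of them
  occurs cofinally often.
\<close>

lemma extends_cofinally_refine:
  fixes \<rho> :: "'a::infinite ord"
  assumes ext: "extends_cofinally \<rho> \<alpha> X Y" and fin: "finite X" "finite Y" and \<delta>: "\<delta> < \<alpha>"
  obtains g where "covering \<rho> (le \<rho>) (X \<union> Y) g" "\<And>x. x \<in> X \<Longrightarrow> g x = x" "g ` Y \<subseteq> {\<delta><..<\<alpha>}"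
    "extends_cofinally \<rho> \<alpha> X (g ` Y)"
proof -
  define good where "good \<gamma> g \<longleftrightarrow>
    covering \<rho> (le \<rho>) (X \<union> Y) g \<and> (\<forall>x\<in>X. g x = x) \<and> g ` Y \<subseteq> {\<gamma><..<\<alpha>}" for \<gamma> g
  \<comment> \<open>The isomorphism type of the image: all relations holding among the values of
    \<open>g\<close>, indexed by arguments so that different coverings can be compared.\<close>
  define T where "T g = {(k, x, y). k \<in> {1, 2::nat} \<and> x \<in> X \<union> Y \<and> y \<in> X \<union> Y \<and> le \<rho> k (g x) (g y)}"
    for g
  define P where "P = Pow ({1, 2::nat} \<times> (X \<union> Y) \<times> (X \<union> Y))"
  have TP: "T g \<in> P" for g unfolding T_def P_def by auto
  have good: "\<exists>g. good \<gamma> g" if "\<gamma> < \<alpha>" for \<gamma>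
    using ext that unfolding extends_cofinally_def good_def by blast
  have "\<exists>t. \<forall>\<gamma><\<alpha>. \<exists>g. good \<gamma> g \<and> T g = t"
  proof (rule ccontr)
    assume "\<not> ?thesis"
    then have "\<forall>t. \<exists>\<gamma>. \<gamma> < \<alpha> \<and> (\<forall>g. good \<gamma> g \<longrightarrow> T g \<noteq> t)" by auto
    \<comment> \<open>\<open>f t\<close> is a bound beyond which type \<open>t\<close> no longer
      occurs. Above the maximum of these finitely many bounds a covering would have no type at
      all.\<close>
    then obtain f where f: "\<And>t. f t < \<alpha>" "\<And>t g. good (f t) g \<Longrightarrow> T g \<noteq> t" by metis
    have finP: "finite (f ` P)" using fin by (simp add: P_def)
    define m where "m = Max (insert \<delta> (f ` P))"
    have m: "m < \<alpha>" using finP f(1) \<delta> unfolding m_def by (auto simp del: Max_insert)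
    then obtain g where g: "good m g" using good by blast
    have "f (T g) \<le> m" unfolding m_def using finP TP by (intro Max_ge) auto
    then have "good (f (T g)) g" using g unfolding good_def by fastforce
    then show False using f(2) by blast
  qed
  then obtain t where t: "\<And>\<gamma>. \<gamma> < \<alpha> \<Longrightarrow> \<exists>g. good \<gamma> g \<and> T g = t" by blast
  obtain g where g: "good \<delta> g" "T g = t" using t[OF \<delta>] by blast
  have im: "X \<union> g ` Y = g ` (X \<union> Y)" using g(1) unfolding good_def by force
  have inj: "inj_on g (X \<union> Y)"
    using g(1) unfolding good_def covering_def by (blast intro: strict_mono_on_imp_inj_on)
  have "extends_cofinally \<rho> \<alpha> X (g ` Y)" unfolding extends_cofinally_def
  proof (intro allI impI)
    fix \<gamma> assume "\<gamma> < \<alpha>"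
    then obtain h where h: "good \<gamma> h" "T h = t" using t by blast
    \<comment> \<open>Carries the image under \<open>g\<close> to the image under \<open>h\<close>.
      As both have type \<open>t\<close>, relations among values of \<open>g\<close> are relations
      among values of \<open>h\<close>.\<close>
    let ?h = "h \<circ> inv_into (X \<union> Y) g"
    have inv: "inv_into (X \<union> Y) g (g x) = x" if "x \<in> X \<union> Y" for x using inv_into_f_f[OF inj that] .
    have "covering \<rho> (le \<rho>) (X \<union> g ` Y) ?h" unfolding im
    proof (rule covering_factor)
      fix k x y assume "k \<in> {1, 2::nat}" "x \<in> X \<union> Y" "y \<in> X \<union> Y" "le \<rho> k (g x) (g y)"
      then have "(k, x, y) \<in> T g" unfolding T_def by blast
      then have "(k, x, y) \<in> T h" using g h by simp
      then show "le \<rho> k (h x) (h y)" unfolding T_def by blast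
    qed (use g(1) h(1) in \<open>simp_all add: good_def\<close>)
    moreover have "?h x = x" if "x \<in> X" for x
      using inv[of x] g(1) h(1) that unfolding good_def by simp
    moreover have "?h ` g ` Y \<subseteq> {\<gamma><..<\<alpha>}"
      using inv h(1) unfolding good_def by (auto simp: image_subset_iff)
    ultimately show "\<exists>h. covering \<rho> (le \<rho>) (X \<union> g ` Y) h \<and> (\<forall>x\<in>X. h x = x) \<and>
        h ` g ` Y \<subseteq> {\<gamma><..<\<alpha>}" by (intro exI[of _ ?h]) blast
  qed
  then show ?thesis using that g(1) unfolding good_def by blast
qed

lemma extends_cofinally_comp:
  assumes g: "covering \<rho> (le \<rho>) (X \<union> Y) g" "\<And>x. x \<in> X \<Longrightarrow> g x = x"
    and ext: "extends_cofinally \<rho> \<beta> X (g ` Y)"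
  shows "extends_cofinally \<rho> \<beta> X Y"
  unfolding extends_cofinally_def
proof (intro allI impI)
  fix \<gamma> assume "\<gamma> < \<beta>"
  from extends_cofinallyE[OF ext this] obtain h where h: "covering \<rho> (le \<rho>) (X \<union> g ` Y) h"
    "\<And>x. x \<in> X \<Longrightarrow> h x = x" "h ` g ` Y \<subseteq> {\<gamma><..<\<beta>}" by metis
  have "X \<union> g ` Y = g ` (X \<union> Y)" using g(2) by force
  then have "covering \<rho> (le \<rho>) (X \<union> Y) (h \<circ> g)" using covering_comp[OF g(1)] h(1) by simp
  then show "\<exists>g. covering \<rho> (le \<rho>) (X \<union> Y) g \<and> (\<forall>x\<in>X. g x = x) \<and> g ` Y \<subseteq> {\<gamma><..<\<beta>}"
    using h(2,3) g(2) by (intro exI[of _ "h \<circ> g"]) (simp add: image_comp)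
qed

lemma extends_cofinally_subset:
  assumes "extends_cofinally \<rho> \<alpha> X Y" "X' \<subseteq> X"
  shows "extends_cofinally \<rho> \<alpha> X' Y"
  unfolding extends_cofinally_def
proof (intro allI impI)
  fix \<gamma> assume "\<gamma> < \<alpha>"
  from extends_cofinallyE[OF assms(1) this] obtain h where h: "covering \<rho> (le \<rho>) (X \<union> Y) h"
    "\<And>x. x \<in> X \<Longrightarrow> h x = x" "h ` Y \<subseteq> {\<gamma><..<\<alpha>}" by metis
  have "covering \<rho> (le \<rho>) (X' \<union> Y) h" by (rule covering_subset[OF h(1)]) (use assms(2) in blast)
  then show "\<exists>g. covering \<rho> (le \<rho>) (X' \<union> Y) g \<and> (\<forall>x\<in>X'. g x = x) \<and> g ` Y \<subseteq> {\<gamma><..<\<alpha>}"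
    using h(2,3) assms(2) by (intro exI[of _ h]) auto
qed

text \<open>Here the lower bound \<open>p + c0\<close> on the images keeps them above
  \<open>p\<close>. The lemma serves twice below: from \<open>q\<close> to \<open>p\<close> below
  the bound \<open>a\<close>, and from \<open>p\<close> to \<open>q\<close> below the bound
  \<open>b\<close>.\<close>

lemma extends_cofinally_shift:
  fixes \<rho> p q :: "'a::infinite ord"
  assumes \<rho>: "0 < \<rho>" "\<rho> dvd p" "\<rho> dvd q"
    and IH: "\<And>k c d. d < b \<Longrightarrow> le \<rho> k (p + c) (p + d) \<longleftrightarrow> le \<rho> k (q + c) (q + d)"
    and ab: "0 < a" "a \<le> b" and X: "X \<subseteq> {..<q + b}" and Y: "Y \<subseteq> {q..<q + b}"
    and ext: "extends_cofinally \<rho> (p + a) (shift q p ` (X \<inter> {q..})) (shift q p ` Y)"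
    and low: "\<And>k u y w. k \<in> {1, 2} \<Longrightarrow> u \<in> X \<Longrightarrow> u < q \<Longrightarrow> y \<in> Y \<Longrightarrow> le \<rho> k u y \<Longrightarrow>
      q \<le> w \<Longrightarrow> w < q + a \<Longrightarrow> le \<rho> k u w"
  shows "extends_cofinally \<rho> (q + a) X Y"
  unfolding extends_cofinally_def
proof (intro allI impI)
  fix \<gamma> assume \<gamma>: "\<gamma> < q + a"
  \<comment> \<open>The offset to stay above on the other side. For \<open>\<gamma>\<close> below
    \<open>q\<close> it is \<open>0\<close>, which is where \<open>0 < a\<close> matters.\<close>
  obtain c0 where c0: "c0 < a" "\<gamma> \<le> q + c0"
  proof (cases "\<gamma> < q")
    case True
    then show ?thesis using that[of 0] ab(1) by simp
  next
    case False
    then obtain c where "\<gamma> = q + c" using ord_diff_ex[of q \<gamma>] by (auto simp: not_less)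
    then show ?thesis using that \<gamma> by simp
  qed
  have pab: "p + a \<le> p + b" using ab by (metis add_ord_less_cancel not_le)
  have "p + c0 < p + a" using c0 by simp
  from extends_cofinallyE[OF ext this] obtain g where
    g: "covering \<rho> (le \<rho>) (shift q p ` (X \<inter> {q..}) \<union> shift q p ` Y) g"
    "\<And>x. x \<in> shift q p ` (X \<inter> {q..}) \<Longrightarrow> g x = x" "g ` shift q p ` Y \<subseteq> {p + c0<..<p + a}" by metis
  define A where "A = shift q p ` ((X \<union> Y) \<inter> {q..})"
  have "Y \<inter> {q..} = Y" using Y by auto
  then have A: "shift q p ` (X \<inter> {q..}) \<union> shift q p ` Y = A"
    unfolding A_def by (simp add: Int_Un_distrib2 image_Un)
  define G where "G v = (if v < q then v else shift p q (g (shift q p v)))" for v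
  have gX: "g (shift q p x) = shift q p x" if "x \<in> X" "q \<le> x" for x
    using g(2) that by blast
  have sX: "shift q p x \<in> {p..<p + b}" if "x \<in> X" "q \<le> x" for x
    using ord_diff_ex[OF that(2)] that(1) X by auto
  have GX: "G x = x" if "x \<in> X" for x
    using gX[OF that] shift_props(1)[of q x p] by (simp add: G_def not_less)
  have GY: "\<exists>d. c0 < d \<and> d < a \<and> g (shift q p y) = p + d \<and> G y = q + d" if "y \<in> Y" for y
  proof -
    have *: "g (shift q p y) \<in> {p + c0<..<p + a}" using g(3) that by blast
    then have "p \<le> g (shift q p y)" using order_trans[OF le_add_ord[of p c0]] by (simp add: less_imp_le)
    then obtain d where "g (shift q p y) = p + d" using ord_diff_ex by blast
    moreover have "y \<in> {q..<q + b}" using Y that by blast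
    ultimately show ?thesis using * by (auto simp: G_def)
  qed
  have "covering \<rho> (le \<rho>) (X \<union> Y) G" unfolding G_def
  proof (rule covering_shift[OF \<rho>, where b = b])
    show "X \<union> Y \<subseteq> {..<q + b}" using X Y by auto
    show "covering \<rho> (le \<rho>) (shift q p ` ((X \<union> Y) \<inter> {q..})) g"
      using g(1) unfolding A A_def .
    show "g ` shift q p ` ((X \<union> Y) \<inter> {q..}) \<subseteq> {p..<p + b}"
    proof
      fix w assume "w \<in> g ` shift q p ` ((X \<union> Y) \<inter> {q..})"
      then obtain x where x: "x \<in> X \<union> Y" "q \<le> x" "w = g (shift q p x)" by auto
      show "w \<in> {p..<p + b}"
      proof (cases "x \<in> X")
        case True
        then show ?thesis using gX sX x by auto
      next
        case False
        then show ?thesis using GY[of x] x pab ab(2) by auto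
      qed
    qed
    fix k u v assume **: "k \<in> {1, 2}" "u \<in> X \<union> Y" "u < q" "v \<in> X \<union> Y" "q \<le> v" "le \<rho> k u v"
    have Gv: "G v = shift p q (g (shift q p v))" using **(5) by (simp add: G_def leD)
    show "le \<rho> k u (shift p q (g (shift q p v)))"
    proof (cases "v \<in> X")
      case True
      then show ?thesis using GX[OF True] **(6) Gv by simp
    next
      case False
      then have v: "v \<in> Y" using ** by blast
      then obtain d where d: "d < a" "G v = q + d" using GY by blast
      have "u \<notin> {q..<q + b}" using **(3) by auto
      then have "u \<in> X" using **(2) Y by blast
      then have "le \<rho> k u (q + d)" using low[OF **(1) _ **(3) v **(6)] d(1) by simp
      then show ?thesis using d(2) Gv by simp
    qed
  qed (rule IH)
  moreover have "G ` Y \<subseteq> {\<gamma><..<q + a}"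
  proof
    fix w assume "w \<in> G ` Y"
    then obtain d where "c0 < d" "d < a" "w = q + d" using GY by blast
    moreover from this have "q + c0 < w" by simp
    ultimately show "w \<in> {\<gamma><..<q + a}" using le_less_trans[OF c0(2)] by simp
  qed
  ultimately show "\<exists>g. covering \<rho> (le \<rho>) (X \<union> Y) g \<and> (\<forall>x\<in>X. g x = x) \<and> g ` Y \<subseteq> {\<gamma><..<q + a}"
    using GX by (intro exI[of _ G]) simp
qed

text \<open>The route is from \<open>q + a\<close> to \<open>p + a\<close> by a shift, from there to
  \<open>p + b\<close> by the upward clause of \<open>le2\<close>, and back to \<open>q + b\<close>
  by a shift.\<close>

lemma extends_cofinally_shift_mono:
  fixes \<rho> p p' q :: "'a::infinite ord"
  assumes \<rho>: "0 < \<rho>" "\<rho> dvd p'" "p = p' + \<rho>" "\<rho> dvd q"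
    and IH: "\<And>k c d. d < b \<Longrightarrow> le \<rho> k (p + c) (p + d) \<longleftrightarrow> le \<rho> k (q + c) (q + d)"
    and H: "not_le_sets \<rho> 2 {..<q} {q..<q + b}"
    and ab: "a < b" and le2: "le \<rho> 2 (p + a) (p + b)" and le1: "le \<rho> 1 (q + a) (q + b)"
    and X: "finite X" "X \<subseteq> {..<q + a}" and Y: "finite Y" "Y \<subseteq> {..<q + a}"
    and cl: "closed_set \<rho> (X \<union> Y)" and XY: "set_less X Y" and ext: "extends_cofinally \<rho> (q + a) X Y"
  shows "extends_cofinally \<rho> (q + b) X Y"
proof -
  have dvd: "\<rho> dvd p"
    using \<rho> by (auto simp: dvd_add_ord_iff dvd_def simp flip: mult_ord_add_one)
  \<comment> \<open>\<open>p\<close> itself is \<open>p' + \<rho>\<close>, which is related only to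
    itself. So \<open>q < q + a\<close>, and there is room to move \<open>Y\<close> above
    \<open>q\<close>.\<close>
  have "a \<noteq> 0"
  proof
    assume "a = 0"
    then have "p = p + b" using le_add_imp_eq[OF \<rho>(1,2), of 2 "p + b"] le2 \<rho>(3) by simp
    then show False using ab add_ord_strict_mono[of 0 b p] by (simp add: \<open>a = 0\<close>)
  qed
  then have a: "0 < a" by (simp add: ord_zero_less_iff)
  then have qqa: "q < q + a" using add_ord_strict_mono[of 0 a q] by simp
  have qab: "q + a < q + b" using ab by simp
  \<comment> \<open>The bound \<open>q\<close> places the image of \<open>Y\<close> above
    \<open>q\<close>, where it can be shifted. The refinement ensures that this image still extends
    cofinally below \<open>q + a\<close>.\<close>
  from extends_cofinally_refine[OF ext X(1) Y(1) qqa] obtain g where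
    g: "covering \<rho> (le \<rho>) (X \<union> Y) g" "\<And>x. x \<in> X \<Longrightarrow> g x = x" "g ` Y \<subseteq> {q<..<q + a}"
    "extends_cofinally \<rho> (q + a) X (g ` Y)" by metis
  define Z where "Z = g ` Y"
  have Z: "finite Z" "Z \<subseteq> {q..<q + a}" using g(3) Y(1) unfolding Z_def by (auto simp: image_subset_iff intro: less_imp_le)
  have "X \<union> Z = g ` (X \<union> Y)" using g(2) unfolding Z_def by force
  then have clZ: "closed_set \<rho> (X \<union> Z)" using closed_set_covering[OF \<rho>(1) cl g(1)] by simp
  define X1 where "X1 = shift q p ` (X \<inter> {q..})"
  define Z1 where "Z1 = shift q p ` Z"
  have sim: "shift q p v \<in> {p..<p + a}" if "v \<in> X \<union> Z" "q \<le> v" for v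
    using ord_diff_ex[OF that(2)] that(1) X(2) Z(2) by auto
  have X1: "finite X1" "X1 \<subseteq> {p..<p + a}" using X(1) sim unfolding X1_def by auto
  have Z1: "finite Z1" "Z1 \<subseteq> {p..<p + a}" using Z sim unfolding Z1_def by (auto simp: subset_iff)
  have "Z \<inter> {q..} = Z" using Z by auto
  then have "X1 \<union> Z1 = shift q p ` ((X \<union> Z) \<inter> {q..})"
    unfolding X1_def Z1_def by (simp add: Int_Un_distrib2 image_Un)
  then have cl1: "closed_set \<rho> (X1 \<union> Z1)" using closed_set_shift[OF \<rho>(1) dvd \<rho>(4) clZ] by simp
  have less1: "set_less X1 Z1" unfolding set_less_def
  proof (intro ballI)
    fix x z assume "x \<in> X1" "z \<in> Z1"
    then obtain x' y where x: "x' \<in> X" "q \<le> x'" "x = shift q p x'" "y \<in> Y" "z = shift q p (g y)"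
      unfolding X1_def Z1_def Z_def by auto
    have "x' < g y" using covering_less[OF g(1), of x' y] XY x g(2) unfolding set_less_def by auto
    moreover have "g y \<in> {q<..<q + a}" using g(3) x(4) by blast
    ultimately show "x < z" using x ord_diff_ex[of q x'] ord_diff_ex[of q "g y"]
      by (auto simp: less_imp_le)
  qed
  have unshift: "shift p q ` (X1 \<inter> {p..}) = X \<inter> {q..}" "shift p q ` Z1 = Z"
  proof -
    have "X1 \<inter> {p..} = X1" using X1(2) by auto
    moreover have "shift p q ` X1 = X \<inter> {q..}"
      unfolding X1_def image_image using shift_props(1)[of q _ p] by simp
    ultimately show "shift p q ` (X1 \<inter> {p..}) = X \<inter> {q..}" by simp
    have "shift p q (shift q p z) = z" if "z \<in> Z" for z using Z(2) that shift_props(1)[of q z p] by auto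
    then show "shift p q ` Z1 = Z" unfolding Z1_def image_image by simp
  qed
  have pab: "p + a < p + b" using ab by simp
  \<comment> \<open>On the side of \<open>p\<close> nothing of \<open>X1\<close> lies below the
    base, so the condition on relations from below is vacuous.\<close>
  have X1p: "\<not> u < p" if "u \<in> X1" for u using subsetD[OF X1(2) that] by (simp add: not_less)
  have "extends_cofinally \<rho> (p + a) X1 Z1"
  proof (rule extends_cofinally_shift[OF \<rho>(1,4) dvd, where b = b])
    show "extends_cofinally \<rho> (q + a) (shift p q ` (X1 \<inter> {p..})) (shift p q ` Z1)"
      unfolding unshift using g(4) extends_cofinally_subset unfolding Z_def by blast
    show "X1 \<subseteq> {..<p + b}" "Z1 \<subseteq> {p..<p + b}" using X1(2) Z1(2) by (auto simp: subset_iff intro: less_trans[OF _ pab])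
  qed (use IH a ab X1p in auto)
  moreover have "\<forall>X Y. finite X \<and> X \<subseteq> {..<p + a} \<and> finite Y \<and> Y \<subseteq> {..<p + a} \<and>
      closed_set \<rho> (X \<union> Y) \<and> set_less X Y \<longrightarrow>
      extends_cofinally \<rho> (p + a) X Y \<longrightarrow> extends_cofinally \<rho> (p + b) X Y"
    using le2 le_2_iff_reflects[of \<rho> "p + a" "p + b"] by simp
  moreover have "X1 \<subseteq> {..<p + a}" "Z1 \<subseteq> {..<p + a}" using X1 Z1 by auto
  ultimately have ext1: "extends_cofinally \<rho> (p + b) X1 Z1" using X1(1) Z1(1) cl1 less1 by simp
  have "extends_cofinally \<rho> (q + b) X Z"
  proof (rule extends_cofinally_shift[OF \<rho>(1) dvd \<rho>(4), where b = b])
    show "extends_cofinally \<rho> (p + b) (shift q p ` (X \<inter> {q..})) (shift q p ` Z)"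
      using ext1 unfolding X1_def Z1_def .
    show "X \<subseteq> {..<q + b}" and Zb: "Z \<subseteq> {q..<q + b}"
      using X(2) Z(2) by (auto simp: subset_iff intro: less_trans[OF _ qab])
    fix k u z w assume *: "k \<in> {1, 2}" "u \<in> X" "u < q" "z \<in> Z" "le \<rho> k u z" "q \<le> w" "w < q + b"
    have "k \<noteq> 2" using H *(3,4,5) Zb unfolding not_le_sets_def by blast
    then have k: "k = 1" using *(1) by blast
    \<comment> \<open>Coverings that fix \<open>u\<close> send \<open>z\<close> arbitrarily far up
      below \<open>q + a\<close>, so \<open>u\<close> is \<open>\<le>\<^sub>1\<close> cofinally many
      ordinals there. The limit \<open>q + a\<close> follows, then \<open>q + b\<close> by
      transitivity through \<open>le1\<close>, and finally the smaller \<open>w\<close>.\<close>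
    have "le \<rho> 1 u (q + a)"
    proof (rule le_1_limit)
      show "u < q + a" using *(3) qqa by simp
      fix \<gamma> assume "\<gamma> < q + a"
      from extends_cofinallyE[OF g(4) this] obtain h where h: "covering \<rho> (le \<rho>) (X \<union> Z) h"
        "\<And>x. x \<in> X \<Longrightarrow> h x = x" "h ` Z \<subseteq> {\<gamma><..<q + a}" unfolding Z_def by metis
      have "le \<rho> 1 u (h z)" using covering_le[OF h(1), of u z 1] *(2,4,5) k h(2)[OF *(2)] by simp
      then show "\<exists>v. \<gamma> < v \<and> v < q + a \<and> le \<rho> 1 u v" using h(3) *(4) by (intro exI[of _ "h z"]) auto
    qed
    then have "le \<rho> 1 u (q + b)" using le_1_trans[OF \<rho>(1) _ le1] by simp
    then show "le \<rho> k u w" unfolding k by (rule le_1_antimono) (use * in auto)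
  qed (use IH a ab in auto)
  then show ?thesis unfolding Z_def using extends_cofinally_comp[OF g(1,2)] by simp
qed

section \<open>Simultaneous transfer of both relations by induction\<close>

lemma le_1_shift_mono:
  fixes \<rho> p p' q :: "'a::infinite ord"
  assumes \<rho>: "0 < \<rho>" "\<rho> dvd p'" "p = p' + \<rho>" "\<rho> dvd q"
    and IH: "\<And>k c d. d < b \<Longrightarrow> le \<rho> k (p + c) (p + d) \<longleftrightarrow> le \<rho> k (q + c) (q + d)"
    and H: "not_le_sets \<rho> 2 {..<q} {q..<q + b}" and le: "le \<rho> 1 (p + a) (p + b)"
  shows "le \<rho> 1 (q + a) (q + b)"
proof -
  have "p + a \<le> p + b" using le by (rule le_imp_less_eq)
  then have ab: "a \<le> b" by (metis add_ord_less_cancel not_le)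
  then have qab: "q + a \<le> q + b" by (metis add_ord_less_cancel not_le)
  have r: "reflects \<rho> (p + a) (p + b) (\<lambda>_. True) (\<lambda>_. True)"
    using le le_1_iff_reflects[of \<rho> "p + a" "p + b"] by simp
  have "reflects \<rho> (q + a) (q + b) (\<lambda>_. True) (\<lambda>_. True)"
    by (rule reflects_shift[OF \<rho> IH H ab r]) simp_all
  then show ?thesis using qab le_1_iff_reflects[of \<rho> "q + a" "q + b"] by simp
qed

text \<open>\<open>IH1\<close> concerns the larger argument \<open>b\<close> itself, which
  \<open>IH\<close> does not reach. The downward clause refers to it, so
  \<open>\<le>\<^sub>1\<close> has to be transferred first at each \<open>b\<close>.\<close>

lemma le_2_shift_mono:
  fixes \<rho> p p' q :: "'a::infinite ord"
  assumes \<rho>: "0 < \<rho>" "\<rho> dvd p'" "p = p' + \<rho>" "\<rho> dvd q"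
    and IH: "\<And>k c d. d < b \<Longrightarrow> le \<rho> k (p + c) (p + d) \<longleftrightarrow> le \<rho> k (q + c) (q + d)"
    and IH1: "\<And>c. le \<rho> 1 (p + c) (p + b) \<longleftrightarrow> le \<rho> 1 (q + c) (q + b)"
    and H: "not_le_sets \<rho> 2 {..<q} {q..<q + b}" and le: "le \<rho> 2 (p + a) (p + b)"
  shows "le \<rho> 2 (q + a) (q + b)"
proof (cases "a = b")
  case True
  then show ?thesis using le_refl[of 2] by simp
next
  case False
  have "p + a \<le> p + b" using le by (rule le_imp_less_eq)
  then have "a \<le> b" by (metis add_ord_less_cancel not_le)
  with False have ab: "a < b" by simp
  then have qab: "q + a < q + b" by simp
  have r: "reflects \<rho> (p + a) (p + b) (\<lambda>y. le \<rho> 1 y (p + b)) (\<lambda>y. le \<rho> 1 y (p + a))"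
    using le le_2_iff_reflects[of \<rho> "p + a" "p + b"] by simp
  have "reflects \<rho> (q + a) (q + b) (\<lambda>y. le \<rho> 1 y (q + b)) (\<lambda>y. le \<rho> 1 y (q + a))"
    by (rule reflects_shift[OF \<rho> IH H \<open>a \<le> b\<close> r]) (use IH[OF ab] IH1 in simp_all)
  moreover have "extends_cofinally \<rho> (q + b) X Y"
    if "finite X" "X \<subseteq> {..<q + a}" "finite Y" "Y \<subseteq> {..<q + a}" "closed_set \<rho> (X \<union> Y)"
      "set_less X Y" "extends_cofinally \<rho> (q + a) X Y" for X Y
    using le_2_imp_le_1[OF le] IH1
    by (intro extends_cofinally_shift_mono[OF \<rho> IH H ab le _ that]) simp_all
  ultimately show ?thesis using less_imp_le[OF qab] le_2_iff_reflects[of \<rho> "q + a" "q + b"] by simp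
qed

text \<open>Both bases have the form of a multiple plus \<open>\<rho>\<close>, because each
  direction of the equivalence uses the preceding multiple on its source side as marker. The
  hypotheses are symmetric, so every one-sided transfer is applied twice.\<close>

lemma le_shift_iff:
  fixes \<rho> p q :: "'a::infinite ord"
  assumes \<rho>: "0 < \<rho>" "\<rho> dvd p" "\<rho> dvd q"
    and H: "not_le_sets \<rho> 2 {..<p + \<rho>} {p + \<rho>..<p + \<rho> + b}"
      "not_le_sets \<rho> 2 {..<q + \<rho>} {q + \<rho>..<q + \<rho> + b}"
  shows "le \<rho> k (p + \<rho> + a) (p + \<rho> + b) \<longleftrightarrow> le \<rho> k (q + \<rho> + a) (q + \<rho> + b)"
  using H
proof (induction b arbitrary: a k rule: less_induct)
  case (less b)
  have dvd: "\<rho> dvd p + \<rho>" "\<rho> dvd q + \<rho>"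
    using \<rho> by (auto simp: dvd_add_ord_iff dvd_def simp flip: mult_ord_add_one)
  have IH: "le \<rho> k (p + \<rho> + c) (p + \<rho> + d) \<longleftrightarrow> le \<rho> k (q + \<rho> + c) (q + \<rho> + d)" if "d < b" for k c d
  proof (rule less.IH[OF that])
    have "{p + \<rho>..<p + \<rho> + d} \<subseteq> {p + \<rho>..<p + \<rho> + b}"
      "{q + \<rho>..<q + \<rho> + d} \<subseteq> {q + \<rho>..<q + \<rho> + b}"
      using that add_ord_strict_mono[OF that, of "p + \<rho>"] add_ord_strict_mono[OF that, of "q + \<rho>"]
      by (simp_all add: ivl_subset less_imp_le)
    then show "not_le_sets \<rho> 2 {..<p + \<rho>} {p + \<rho>..<p + \<rho> + d}"
      "not_le_sets \<rho> 2 {..<q + \<rho>} {q + \<rho>..<q + \<rho> + d}"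
      using less.prems unfolding not_le_sets_def by blast+
  qed
  have IH1: "le \<rho> 1 (p + \<rho> + c) (p + \<rho> + b) \<longleftrightarrow> le \<rho> 1 (q + \<rho> + c) (q + \<rho> + b)" for c
    using le_1_shift_mono[OF \<rho>(1,2) refl dvd(2) IH less.prems(2)]
      le_1_shift_mono[OF \<rho>(1,3) refl dvd(1) IH[symmetric] less.prems(1)] by blast
  have IH2: "le \<rho> 2 (p + \<rho> + c) (p + \<rho> + b) \<longleftrightarrow> le \<rho> 2 (q + \<rho> + c) (q + \<rho> + b)" for c
    using le_2_shift_mono[OF \<rho>(1,2) refl dvd(2) IH IH1 less.prems(2)]
      le_2_shift_mono[OF \<rho>(1,3) refl dvd(1) IH[symmetric] IH1[symmetric] less.prems(1)] by blast
  have "le \<rho> k \<alpha> \<beta> \<Longrightarrow> k = 1 \<or> k = 2" for \<alpha> \<beta> :: "'a ord" using le_unfold[of \<rho> k \<alpha> \<beta>] by auto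
  then show ?case using IH1 IH2 by metis
qed

section \<open>Assembly of the isomorphism from the first partial block and the blocks after
  it\<close>

theorem mainTheorem1:
  fixes \<rho> \<alpha> \<gamma> :: "'a::infinite ord"
  assumes "indecomposable \<rho>"
    and "\<not> \<rho> dvd \<alpha>"
    and "not_le_sets \<rho> 2 {0..<\<alpha>} {\<alpha>..<\<alpha> + \<gamma>}"
  shows "isomorphic \<rho> {1..1 + \<gamma>} {\<alpha>..\<alpha> + \<gamma>}"
proof -
  have \<rho>: "0 < \<rho>" using assms(1) by (simp add: indecomposable_def ord_zero_less_iff)
  obtain \<zeta> \<epsilon> where \<alpha>: "\<alpha> = \<rho> * \<zeta> + \<epsilon>" "\<epsilon> < \<rho>" using ord_division[OF \<rho>] by blast
  have "\<epsilon> \<noteq> 0" using assms(2) \<alpha> by (auto simp: dvd_def)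
  then have \<epsilon>: "0 < \<epsilon>" by (simp add: ord_zero_less_iff)
  then have "1 \<le> \<epsilon>" using less_one_ord_iff[of \<epsilon>] by (simp add: not_less[symmetric])
  then have one: "1 < \<rho>" using \<alpha>(2) by simp
  \<comment> \<open>The first multiple of \<open>\<rho>\<close> after \<open>\<alpha>\<close>. It
    corresponds to \<open>\<rho>\<close> on the side of \<open>1\<close>.\<close>
  define q where "q = \<rho> * \<zeta> + \<rho>"
  have dvd: "\<rho> dvd \<rho> * \<zeta>" "\<rho> dvd q" "\<rho> dvd \<rho>" "\<rho> dvd 0"
    using \<rho> unfolding q_def dvd_def
    by (metis mult_ord_add_one mult_ord_zero_right add_ord_zero_left)+
  have base: "\<rho> * \<zeta> < \<alpha>" using add_ord_strict_mono[OF \<epsilon>, of "\<rho> * \<zeta>"] by (simp add: \<alpha>)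
  have small: "1 + d < \<rho>" "0 < 1 + d" "\<alpha> + d = \<rho> * \<zeta> + (\<epsilon> + d)" "\<epsilon> + d < \<rho>" "0 < \<epsilon> + d" "\<alpha> + d < q"
    if "d < \<rho>" for d
  proof -
    show "1 + d < \<rho>" "\<epsilon> + d < \<rho>" using assms(1) that one \<alpha>(2) unfolding indecomposable_def by blast+
    then show "\<alpha> + d < q" by (simp add: \<alpha>(1) add_ord_assoc q_def)
    show "0 < 1 + d" using less_le_trans[OF _ le_add_ord[of 1 d], of 0] less_one_ord_iff[of 0] by simp
    show "0 < \<epsilon> + d" using less_le_trans[OF \<epsilon> le_add_ord] .
    show "\<alpha> + d = \<rho> * \<zeta> + (\<epsilon> + d)" by (simp add: \<alpha>(1) add_ord_assoc)
  qed
  have ndvd: "\<not> \<rho> dvd 1 + d" "\<not> \<rho> dvd \<alpha> + d" if "d < \<rho>" for d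
    using dvd_add_mult_iff[OF small(1)[OF that], of 0] dvd_add_mult_iff[OF small(4)[OF that], of \<zeta>]
      small[OF that] by auto
  \<comment> \<open>From \<open>d = \<rho>\<close> on, the summands \<open>1\<close> and
    \<open>\<epsilon>\<close> are absorbed, and the isomorphism becomes
    \<open>\<rho> + c \<mapsto> q + c\<close>.\<close>
  have big: "1 + (\<rho> + c) = \<rho> + c" "\<alpha> + (\<rho> + c) = q + c" for c
    using add_ord_right_absorb[OF assms(1) one] add_ord_right_absorb[OF assms(1) \<alpha>(2)]
    unfolding q_def \<alpha>(1) by (metis add_ord_assoc)+
  have cases: "d < \<rho> \<or> (\<exists>c. d = \<rho> + c)" for d using ord_diff_ex[of \<rho> d] not_less by blast
  have f_op: "f_op \<rho> \<xi> (1 + d) = 1 + e \<longleftrightarrow> f_op \<rho> \<xi> (\<alpha> + d) = \<alpha> + e" for d e \<xi>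
  proof (cases "d < \<rho>")
    case True
    \<comment> \<open>Both values are block bases, lying below \<open>1\<close> and below
      \<open>\<alpha>\<close> respectively, so neither equation can hold.\<close>
    have "f_op \<rho> \<xi> (1 + d) = 0" using f_op_mult_add[OF small(2,1)[OF True], of \<xi> 0] by simp
    moreover have "f_op \<rho> \<xi> (\<alpha> + d) = \<rho> * \<zeta>"
      using f_op_mult_add[OF small(5,4)[OF True], of \<xi> \<zeta>] small(3)[OF True] by simp
    moreover have "\<rho> * \<zeta> < \<alpha> + e" using base le_add_ord by (rule less_le_trans)
    moreover have "0 < 1 + e"
      using less_le_trans[OF _ le_add_ord[of 1 e], of 0] less_one_ord_iff[of 0] by simp
    ultimately show ?thesis by auto
  next
    case False
    then obtain c where c: "d = \<rho> + c" using cases by blast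
    show ?thesis
    proof (cases "e < \<rho>")
      case True
      have "1 + e < \<rho> + f_op \<rho> \<xi> c" "\<alpha> + e < q + f_op \<rho> \<xi> c"
        using small(1,6)[OF True] le_add_ord by (auto intro: less_le_trans)
      then show ?thesis
        unfolding c big f_op_add[OF \<rho> dvd(3)] f_op_add[OF \<rho> dvd(2)] by auto
    next
      case False
      then obtain c' where c': "e = \<rho> + c'" using cases by blast
      show ?thesis unfolding c c' big f_op_add[OF \<rho> dvd(3)] f_op_add[OF \<rho> dvd(2)] by simp
    qed
  qed
  have le: "le \<rho> k (1 + d) (1 + e) \<longleftrightarrow> le \<rho> k (\<alpha> + d) (\<alpha> + e)" if "k \<in> {1, 2}" "e \<le> \<gamma>" for k d e
  proof (cases "d < \<rho>")
    case True
    have "le \<rho> k (1 + d) (1 + e) \<longleftrightarrow> d = e"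
      using le_not_dvd_imp_eq[OF \<rho> ndvd(1)[OF True], of k "1 + e"] le_refl[OF that(1)] by auto
    moreover have "le \<rho> k (\<alpha> + d) (\<alpha> + e) \<longleftrightarrow> d = e"
      using le_not_dvd_imp_eq[OF \<rho> ndvd(2)[OF True], of k "\<alpha> + e"] le_refl[OF that(1)] by auto
    ultimately show ?thesis by simp
  next
    case False
    then obtain c where c: "d = \<rho> + c" using cases by blast
    show ?thesis
    proof (cases "e < \<rho>")
      case True
      then have "1 + e < 1 + d" "\<alpha> + e < \<alpha> + d" using False by simp_all
      then show ?thesis using le_imp_less_eq by (metis leD)
    next
      case False
      then obtain c' where c': "e = \<rho> + c'" using cases by blast
      \<comment> \<open>On the side of \<open>1\<close> the condition is automatic: below
        \<open>\<rho>\<close> there are only \<open>0\<close> and non-multiples of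
        \<open>\<rho>\<close>, all related only to themselves.\<close>
      have "not_le_sets \<rho> 2 {..<0 + \<rho>} {0 + \<rho>..<0 + \<rho> + c'}" unfolding not_le_sets_def
      proof (intro ballI notI)
        fix u v assume uv: "u \<in> {..<0 + \<rho>}" "v \<in> {0 + \<rho>..<0 + \<rho> + c'}" "le \<rho> 2 u v"
        then have "u < v" "u < \<rho>" by auto
        show False
        proof (cases "u = 0")
          case True
          then show False using le_0_imp_eq[OF \<rho>, of 2 v] uv(3) \<open>u < v\<close> by simp
        next
          case False
          then have "\<not> \<rho> dvd u" using dvd_add_mult_iff[OF \<open>u < \<rho>\<close>, of 0] by simp
          then show False using le_not_dvd_imp_eq[OF \<rho> _ uv(3)] \<open>u < v\<close> by simp
        qed
      qed
      \<comment> \<open>The assumption of the theorem covers \<open>u < \<alpha>\<close>. The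
        remaining \<open>u\<close> between \<open>\<alpha>\<close> and \<open>q\<close> are not
        divisible by \<open>\<rho>\<close>, so they are related only to themselves.\<close>
      moreover have "not_le_sets \<rho> 2 {..<\<rho> * \<zeta> + \<rho>} {\<rho> * \<zeta> + \<rho>..<\<rho> * \<zeta> + \<rho> + c'}"
        unfolding not_le_sets_def q_def[symmetric]
      proof (intro ballI notI)
        fix u v assume uv: "u \<in> {..<q}" "v \<in> {q..<q + c'}" "le \<rho> 2 u v"
        \<comment> \<open>The assumption stops before \<open>\<alpha> + \<gamma>\<close>, while
          \<open>e = \<gamma>\<close> is allowed. It suffices because only arguments strictly below
          \<open>\<alpha> + e\<close> enter.\<close>
        have "v < \<alpha> + e" using uv(2) unfolding c' big by simp
        also have "\<dots> \<le> \<alpha> + \<gamma>" using that(2) by (metis add_ord_less_cancel not_le)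
        finally have v: "v < \<alpha> + \<gamma>" .
        have "\<alpha> < q" using small(6)[OF \<rho>] by simp
        then have v': "\<alpha> \<le> v" using uv(2) by auto
        show False
        proof (cases "u < \<alpha>")
          case True
          then show False using assms(3) uv(3) v v' unfolding not_le_sets_def by auto
        next
          case False
          then obtain c where u: "u = \<alpha> + c" using ord_diff_ex[of \<alpha> u] by (auto simp: not_less)
          have "c < \<rho>"
          proof (rule ccontr)
            assume "\<not> c < \<rho>"
            then obtain c'' where "c = \<rho> + c''" using cases by blast
            then show False using uv(1) le_add_ord[of q c''] unfolding u by (simp add: big leD)
          qed
          then have "u = v" using le_not_dvd_imp_eq[OF \<rho> ndvd(2), of c 2 v] uv(3) u by simp
          then show False using uv(1,2) by auto
        qed
      qed
      ultimately have "le \<rho> k (0 + \<rho> + c) (0 + \<rho> + c') \<longleftrightarrow>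
          le \<rho> k (\<rho> * \<zeta> + \<rho> + c) (\<rho> * \<zeta> + \<rho> + c')"
        by (rule le_shift_iff[OF \<rho> dvd(4,1)])
      then show ?thesis unfolding c c' big by (simp add: q_def)
    qed
  qed
  have mem: "\<exists>d\<le>\<gamma>. x = \<beta> + d" if "x \<in> {\<beta>..\<beta> + \<gamma>}" for x \<beta> :: "'a ord"
  proof -
    have "\<beta> \<le> x" using that by simp
    then obtain d where d: "x = \<beta> + d" using ord_diff_ex by blast
    then show ?thesis using that by (metis add_ord_less_cancel atLeastAtMost_iff not_le)
  qed
  have le_mono: "\<beta> + d \<le> \<beta> + \<gamma>" if "d \<le> \<gamma>" for d \<beta> :: "'a ord"
    using that by (metis add_ord_less_cancel not_le)
  let ?h = "shift 1 \<alpha>"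
  have mono: "strict_mono_on {1..1 + \<gamma>} ?h"
  proof (rule strict_mono_onI)
    fix x y assume "x \<in> {1..1 + \<gamma>}" "y \<in> {1..1 + \<gamma>}" "x < y"
    then show "?h x < ?h y" using mem[of x 1] mem[of y 1] by auto
  qed
  have "?h ` {1..1 + \<gamma>} = {\<alpha>..\<alpha> + \<gamma>}"
  proof (intro equalityI subsetI)
    fix y assume "y \<in> ?h ` {1..1 + \<gamma>}"
    then obtain x where "x \<in> {1..1 + \<gamma>}" "y = ?h x" by blast
    then show "y \<in> {\<alpha>..\<alpha> + \<gamma>}" using mem[of x 1] le_mono by auto
  next
    fix y assume "y \<in> {\<alpha>..\<alpha> + \<gamma>}"
    then obtain d where "d \<le> \<gamma>" "y = \<alpha> + d" using mem by blast
    then show "y \<in> ?h ` {1..1 + \<gamma>}" using le_mono by (intro image_eqI[of _ _ "1 + d"]) auto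
  qed
  then have bij: "bij_betw ?h {1..1 + \<gamma>} {\<alpha>..\<alpha> + \<gamma>}"
    using strict_mono_on_imp_inj_on[OF mono] by (simp add: bij_betw_def)
  have "(\<forall>\<xi><\<rho>. f_op \<rho> \<xi> x = y \<longleftrightarrow> f_op \<rho> \<xi> (?h x) = ?h y) \<and>
      (\<forall>k\<in>{1, 2}. le \<rho> k x y \<longleftrightarrow> le \<rho> k (?h x) (?h y))"
    if xy: "x \<in> {1..1 + \<gamma>}" "y \<in> {1..1 + \<gamma>}" for x y
  proof -
    obtain d e where de: "x = 1 + d" "y = 1 + e" "e \<le> \<gamma>" using mem[OF xy(1)] mem[OF xy(2)] by blast
    show ?thesis unfolding de shift_add using f_op le de(3) by blast
  qed
  with bij mono show ?thesis unfolding isomorphic_def by blast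
qed

end
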